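(* Let $d\ge1$ be an integer, and let $G$ and $S$ be such that the Cayley graph $X(G,S)$ is the homogeneous tree with degree $d+1$. Then for any symmetric probability measure $\mu$ on $G$ supported by $S$ (i.e. with support $S$), the associated switch-walk-switch random walk on $H\wr G$ (with law $\widetilde\mu=\nu*\mu*\nu$) has pure point spectrum whenever the finite group $H$ of lamps satisfies $|H|\ge d$ (and $|H|\ge2$).
   Context: $G$ is a finitely generated group with identity $e$ and $S$ is a finite symmetric generating set; the Cayley graph $X(G,S)$ has vertex set $G$ and unoriented edges $[x,xs]$, $x\in G$, $s\in S$. $H$ is a finite group with identity $o$. Let $\mathcal{L}=\bigoplus_G H$ be the group (under pointwise multiplication) of functions $\eta:G\to H$ with finite support $\{x:\eta(x)\ne o\}$; its identity is $\iota\equiv o$. $G$ acts on $\mathcal L$ by $L_g\eta(x)=\eta(g^{-1}x)$, and the lamplighter group is $H\wr G=\mathcal{L}\rtimes G$ with $(\eta,g)(\eta',g')=(\eta\cdot L_g\eta',gg')$. $G$ and $H$ embed into $H\wr G$ via $g\mapsto(\iota,g)$ and $h\mapsto(\eta_e^h,e)$, where $\eta_e^h(e)=h$ and $\eta_e^h(x)=o$ for $x\neq e$; measures on $G$ and $H$ are regarded as measures on $H\wr G$ via these embeddings. $\nu$ is the uniform distribution on $H$. The switch-walk-switch random walk associated with $\mu$ is the random walk on $H\wr G$ with law $\widetilde\mu=\nu*\mu*\nu$; its transition operator is the self-adjoint operator $F\mapsto F*\widetilde\mu$ on $\ell^2(H\wr G)$. The spectrum of a self-adjoint operator is called pure point if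 the Hilbert space has a complete orthonormal system of eigenvectors; the random walk has pure point spectrum if its transition operator does. *)

theory Defs
  imports
    "HOL-Algebra.Product_Groups"
    "HOL-Algebra.Generated_Groups"
    "HOL-Analysis.Infinite_Sum"
    "HOL-Probability.Probability_Mass_Function"
begin

section \<open>Undirected graphs, Cayley graphs and homogeneous trees\<close>

text \<open>
  A graph is given by a vertex set \<open>V\<close> and a set \<open>E\<close> of unoriented edges \<open>{x, y}\<close>;
  a loop at \<open>x\<close> is the edge \<open>{x}\<close>. The trees of the AFP entry on graph theory are not
  usable here: they are digraphs, in which two opposite arcs already form a cycle.
\<close>

definition walk :: "'v set \<Rightarrow> 'v set set \<Rightarrow> 'v list \<Rightarrow> bool" where
  "walk V E p \<longleftrightarrow> p \<noteq> [] \<and> set p \<subseteq> V \<and> (\<forall>i. Suc i < length p \<longrightarrow> {p ! i, p ! Suc i} \<in> E)"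

definition connected_graph :: "'v set \<Rightarrow> 'v set set \<Rightarrow> bool" where
  "connected_graph V E \<longleftrightarrow>
     V \<noteq> {} \<and> (\<forall>x\<in>V. \<forall>y\<in>V. \<exists>p. walk V E p \<and> hd p = x \<and> last p = y)"

text \<open>
  A cycle is listed without repeating its initial vertex. Edges form a set, so there are no
  cycles of length two; loops are cycles of length one.
\<close>

definition graph_cycle :: "'v set \<Rightarrow> 'v set set \<Rightarrow> 'v list \<Rightarrow> bool" where
  "graph_cycle V E p \<longleftrightarrow>
     walk V E p \<and> distinct p \<and> {last p, hd p} \<in> E \<and> length p \<noteq> 2"

definition is_tree :: "'v set \<Rightarrow> 'v set set \<Rightarrow> bool" where
  "is_tree V E \<longleftrightarrow> connected_graph V E \<and> (\<nexists>p. graph_cycle V E p)"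

definition homogeneous_tree :: "nat \<Rightarrow> 'v set \<Rightarrow> 'v set set \<Rightarrow> bool" where
  "homogeneous_tree q V E \<longleftrightarrow> is_tree V E \<and> (\<forall>x\<in>V. card {y \<in> V. {x, y} \<in> E} = q)"

definition cayley_edges :: "('g, 'a) monoid_scheme \<Rightarrow> 'g set \<Rightarrow> 'g set set" where
  "cayley_edges G S = {{x, x \<otimes>\<^bsub>G\<^esub> s} | x s. x \<in> carrier G \<and> s \<in> S}"

definition symmetric_generating_set :: "('g, 'a) monoid_scheme \<Rightarrow> 'g set \<Rightarrow> bool" where
  "symmetric_generating_set G S \<longleftrightarrow>
     S \<subseteq> carrier G \<and> (\<forall>s\<in>S. inv\<^bsub>G\<^esub> s \<in> S) \<and> generate G S = carrier G"

section \<open>Lamplighter groups\<close>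

text \<open>
  In the library, the elements of \<^const>\<open>sum_group\<close> are the finitely supported
  functions on the index set, with the value \<^const>\<open>undefined\<close> outside it.
\<close>

definition lamp_configs :: "('g, 'a) monoid_scheme \<Rightarrow> ('h, 'b) monoid_scheme \<Rightarrow> ('g \<Rightarrow> 'h) monoid" where
  "lamp_configs G H = sum_group (carrier G) (\<lambda>_. H)"

definition translate :: "('g, 'a) monoid_scheme \<Rightarrow> 'g \<Rightarrow> ('g \<Rightarrow> 'h) \<Rightarrow> 'g \<Rightarrow> 'h" where
  "translate G g \<eta> = (\<lambda>x\<in>carrier G. \<eta> (inv\<^bsub>G\<^esub> g \<otimes>\<^bsub>G\<^esub> x))"

definition lamplighter ::
  "('h, 'b) monoid_scheme \<Rightarrow> ('g, 'a) monoid_scheme \<Rightarrow> (('g \<Rightarrow> 'h) \<times> 'g) monoid" where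
  "lamplighter H G =
     \<lparr>carrier = carrier (lamp_configs G H) \<times> carrier G,
      monoid.mult = (\<lambda>(\<eta>, g) (\<eta>', g').
        (\<eta> \<otimes>\<^bsub>lamp_configs G H\<^esub> translate G g \<eta>', g \<otimes>\<^bsub>G\<^esub> g')),
      one = (\<one>\<^bsub>lamp_configs G H\<^esub>, \<one>\<^bsub>G\<^esub>)\<rparr>"

definition embed_base ::
  "('h, 'b) monoid_scheme \<Rightarrow> ('g, 'a) monoid_scheme \<Rightarrow> 'g \<Rightarrow> ('g \<Rightarrow> 'h) \<times> 'g" where
  "embed_base H G g = (\<one>\<^bsub>lamp_configs G H\<^esub>, g)"

definition embed_lamp ::
  "('h, 'b) monoid_scheme \<Rightarrow> ('g, 'a) monoid_scheme \<Rightarrow> 'h \<Rightarrow> ('g \<Rightarrow> 'h) \<times> 'g" where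
  "embed_lamp H G h = (\<lambda>x\<in>carrier G. if x = \<one>\<^bsub>G\<^esub> then h else \<one>\<^bsub>H\<^esub>, \<one>\<^bsub>G\<^esub>)"

lemma sum_group_const_mult:
  "monoid.mult (lamp_configs G H) \<eta> \<eta>' = (\<lambda>x\<in>carrier G. \<eta> x \<otimes>\<^bsub>H\<^esub> \<eta>' x)"
  by (simp add: lamp_configs_def sum_group_def)

lemma translate_closed:
  assumes "group G" "group H" "g \<in> carrier G" "\<eta> \<in> carrier (lamp_configs G H)"
  shows "translate G g \<eta> \<in> carrier (lamp_configs G H)"
proof -
  interpret G: group G by fact
  interpret H: group H by fact
  have \<eta>: "\<eta> \<in> carrier G \<rightarrow>\<^sub>E carrier H" "finite {x \<in> carrier G. \<eta> x \<noteq> \<one>\<^bsub>H\<^esub>}"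
    using assms by (auto simp: lamp_configs_def carrier_sum_group)
  have "{x \<in> carrier G. \<eta> (inv\<^bsub>G\<^esub> g \<otimes>\<^bsub>G\<^esub> x) \<noteq> \<one>\<^bsub>H\<^esub>}
        \<subseteq> (\<lambda>x. g \<otimes>\<^bsub>G\<^esub> x) ` {x \<in> carrier G. \<eta> x \<noteq> \<one>\<^bsub>H\<^esub>}"
  proof
    fix x assume x: "x \<in> {x \<in> carrier G. \<eta> (inv\<^bsub>G\<^esub> g \<otimes>\<^bsub>G\<^esub> x) \<noteq> \<one>\<^bsub>H\<^esub>}"
    then have "x = g \<otimes>\<^bsub>G\<^esub> (inv\<^bsub>G\<^esub> g \<otimes>\<^bsub>G\<^esub> x)"
      using assms(3) by (simp add: G.m_assoc[symmetric])
    then show "x \<in> (\<lambda>x. g \<otimes>\<^bsub>G\<^esub> x) ` {x \<in> carrier G. \<eta> x \<noteq> \<one>\<^bsub>H\<^esub>}"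
      using x assms(3) by (intro image_eqI) auto
  qed
  then have "finite {x \<in> carrier G. translate G g \<eta> x \<noteq> \<one>\<^bsub>H\<^esub>}"
    using \<eta>(2) by (auto simp: translate_def cong: conj_cong elim!: finite_subset)
  then show ?thesis
    using \<eta>(1) assms(3)
    by (auto simp: lamp_configs_def carrier_sum_group translate_def PiE_iff)
qed

lemma group_lamplighter:
  assumes "group G" "group H"
  shows "group (lamplighter H G)"
proof -
  interpret G: group G by fact
  interpret H: group H by fact
  interpret C: group "lamp_configs G H"
    using assms(2) by (simp add: lamp_configs_def)
  have val: "\<eta> x \<in> carrier H" if "\<eta> \<in> carrier (lamp_configs G H)" "x \<in> carrier G" for \<eta> x
    using that by (auto simp: lamp_configs_def carrier_sum_group)
  have ext: "\<eta> \<in> extensional (carrier G)" if "\<eta> \<in> carrier (lamp_configs G H)" for \<eta>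
    using that by (auto simp: lamp_configs_def carrier_sum_group PiE_iff)
  have tr_mult: "translate G g (\<eta> \<otimes>\<^bsub>lamp_configs G H\<^esub> \<eta>') =
      translate G g \<eta> \<otimes>\<^bsub>lamp_configs G H\<^esub> translate G g \<eta>'"
    if "g \<in> carrier G" for g \<eta> \<eta>'
    using that by (auto simp: translate_def sum_group_const_mult fun_eq_iff)
  have tr_tr: "translate G g (translate G g' \<eta>) = translate G (g \<otimes>\<^bsub>G\<^esub> g') \<eta>"
    if "g \<in> carrier G" "g' \<in> carrier G" for g g' and \<eta> :: "'a \<Rightarrow> 'c"
    using that by (auto simp: translate_def fun_eq_iff G.inv_mult_group G.m_assoc)
  have tr_one: "translate G \<one>\<^bsub>G\<^esub> \<eta> = \<eta>" if "\<eta> \<in> carrier (lamp_configs G H)" for \<eta>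
    using ext[OF that] by (auto simp: translate_def extensional_def fun_eq_iff)
  note cl = translate_closed[OF assms]
  show ?thesis
  proof (rule groupI)
    fix x assume "x \<in> carrier (lamplighter H G)"
    then obtain \<eta> g where x: "x = (\<eta>, g)" "\<eta> \<in> carrier (lamp_configs G H)" "g \<in> carrier G"
      by (auto simp: lamplighter_def)
    let ?y = "(translate G (inv\<^bsub>G\<^esub> g) (inv\<^bsub>lamp_configs G H\<^esub> \<eta>), inv\<^bsub>G\<^esub> g)"
    have "?y \<in> carrier (lamplighter H G)" "?y \<otimes>\<^bsub>lamplighter H G\<^esub> x = \<one>\<^bsub>lamplighter H G\<^esub>"
      using x cl tr_mult[of "inv\<^bsub>G\<^esub> g" "inv\<^bsub>lamp_configs G H\<^esub> \<eta>" \<eta>, symmetric]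
      by (auto simp: lamplighter_def)
         (auto simp: translate_def lamp_configs_def fun_eq_iff)
    then show "\<exists>y\<in>carrier (lamplighter H G). y \<otimes>\<^bsub>lamplighter H G\<^esub> x = \<one>\<^bsub>lamplighter H G\<^esub>"
      by blast
  qed (auto simp: lamplighter_def cl tr_mult tr_tr tr_one C.m_assoc G.m_assoc)
qed

section \<open>The switch-walk-switch random walk\<close>

definition pmf_convolution :: "('a, 'b) monoid_scheme \<Rightarrow> 'a pmf \<Rightarrow> 'a pmf \<Rightarrow> 'a pmf" where
  "pmf_convolution L p q = map_pmf (\<lambda>(x, y). x \<otimes>\<^bsub>L\<^esub> y) (pair_pmf p q)"

definition symmetric_pmf :: "('g, 'a) monoid_scheme \<Rightarrow> 'g pmf \<Rightarrow> bool" where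
  "symmetric_pmf G \<mu> \<longleftrightarrow> (\<forall>x\<in>carrier G. pmf \<mu> (inv\<^bsub>G\<^esub> x) = pmf \<mu> x)"

definition switch_walk_switch ::
  "('h, 'b) monoid_scheme \<Rightarrow> ('g, 'a) monoid_scheme \<Rightarrow> 'g pmf \<Rightarrow> (('g \<Rightarrow> 'h) \<times> 'g) pmf" where
  "switch_walk_switch H G \<mu> =
     (let \<nu> = map_pmf (embed_lamp H G) (pmf_of_set (carrier H))
      in pmf_convolution (lamplighter H G)
           (pmf_convolution (lamplighter H G) \<nu> (map_pmf (embed_base H G) \<mu>)) \<nu>)"

section \<open>Pure point spectrum on square-summable functions\<close>

text \<open>
  Elements of \<open>ell2 X\<close> are represented by functions on the whole type that vanish
  outside \<open>X\<close>, so that equality of vectors is equality of functions.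
\<close>

definition ell2 :: "'x set \<Rightarrow> ('x \<Rightarrow> complex) set" where
  "ell2 X = {F. (\<forall>x. x \<notin> X \<longrightarrow> F x = 0) \<and> (\<lambda>x. (cmod (F x))\<^sup>2) summable_on X}"

definition ell2_inner :: "'x set \<Rightarrow> ('x \<Rightarrow> complex) \<Rightarrow> ('x \<Rightarrow> complex) \<Rightarrow> complex" where
  "ell2_inner X F F' = (\<Sum>\<^sub>\<infinity>x\<in>X. F x * cnj (F' x))"

definition ell2_norm :: "'x set \<Rightarrow> ('x \<Rightarrow> complex) \<Rightarrow> real" where
  "ell2_norm X F = sqrt (\<Sum>\<^sub>\<infinity>x\<in>X. (cmod (F x))\<^sup>2)"

definition orthonormal_system :: "'x set \<Rightarrow> ('x \<Rightarrow> complex) set \<Rightarrow> bool" where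
  "orthonormal_system X B \<longleftrightarrow>
     B \<subseteq> ell2 X \<and> (\<forall>b\<in>B. \<forall>b'\<in>B. ell2_inner X b b' = (if b = b' then 1 else 0))"

text \<open>Completeness: the finite linear combinations are dense.\<close>

definition complete_system :: "'x set \<Rightarrow> ('x \<Rightarrow> complex) set \<Rightarrow> bool" where
  "complete_system X B \<longleftrightarrow>
     (\<forall>F\<in>ell2 X. \<forall>\<epsilon>>0. \<exists>A c. finite A \<and> A \<subseteq> B \<and>
        ell2_norm X (\<lambda>x. F x - (\<Sum>b\<in>A. c b * b x)) < \<epsilon>)"

definition eigenvector ::
  "'x set \<Rightarrow> (('x \<Rightarrow> complex) \<Rightarrow> 'x \<Rightarrow> complex) \<Rightarrow> ('x \<Rightarrow> complex) \<Rightarrow> bool" where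
  "eigenvector X T F \<longleftrightarrow> F \<in> ell2 X \<and> F \<noteq> (\<lambda>_. 0) \<and> (\<exists>c. T F = (\<lambda>x. c * F x))"

definition pure_point_spectrum :: "'x set \<Rightarrow> (('x \<Rightarrow> complex) \<Rightarrow> 'x \<Rightarrow> complex) \<Rightarrow> bool" where
  "pure_point_spectrum X T \<longleftrightarrow>
     (\<exists>B. orthonormal_system X B \<and> complete_system X B \<and> (\<forall>b\<in>B. eigenvector X T b))"

text \<open>\<open>F \<mapsto> F * p\<close>, extended by zero outside the group.\<close>

definition transition_operator ::
  "('a, 'b) monoid_scheme \<Rightarrow> 'a pmf \<Rightarrow> ('a \<Rightarrow> complex) \<Rightarrow> 'a \<Rightarrow> complex" where
  "transition_operator L p F x =
     (if x \<in> carrier L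
      then \<Sum>\<^sub>\<infinity>y\<in>carrier L. F (x \<otimes>\<^bsub>L\<^esub> inv\<^bsub>L\<^esub> y) * complex_of_real (pmf p y)
      else 0)"

definition random_walk_pure_point :: "('a, 'b) monoid_scheme \<Rightarrow> 'a pmf \<Rightarrow> bool" where
  "random_walk_pure_point L p \<longleftrightarrow> pure_point_spectrum (carrier L) (transition_operator L p)"

end

theory Submission
  imports
    Defs
    "HOL-Computational_Algebra.Fundamental_Theorem_Algebra"
    "HOL-Library.Function_Algebras"
begin

text \<open>
  Split the uniform averaging over the lamp at each site \<open>x\<close> of a finite window \<open>B\<close> into the
  projection onto functions not depending on the lamp at \<open>x\<close> and the complementary projection, and
  call \<open>x\<close> open when the first one is chosen. This decomposes a point mass at a lamp configuration
  into orthogonal vectors \<open>f\<^sub>D\<close>, one for each set \<open>D\<close> of open sites, with squared norm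
  \<open>p\<^bsup>|D|\<^esup> (1 - p)\<^bsup>|B - D|\<^esup>\<close> for \<open>p = 1 / |H|\<close>: Bernoulli site percolation. The walk operator kills
  what it would carry to a closed site, so if the open cluster \<open>C\<close> of \<open>r\<close> and its boundary lie in
  \<open>B\<close>, then \<open>f\<^sub>D \<otimes> \<delta>\<^sub>r\<close> lies in the invariant space \<open>f\<^sub>D \<otimes> \<complex>\<^sup>C\<close>, which is finite-dimensional and hence
  spanned by eigenvectors. The remaining part of the point mass has as its squared norm the
  probability that the cluster reaches the end of the window, which vanishes in the limit because
  \<open>p \<le> 1 / d\<close> is not above the critical value of the tree.
\<close>

section \<open>Trees with a root\<close>

text \<open>Uniform switching averages the lamp at the site left and the lamp at the site entered,
  so the walk operator is the walk on positions combined with commuting orthogonal projections on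
  lamps. The choice of open or closed at every site survives each step, which leaves a walk killed
  at the boundary of the open cluster. The window makes the decomposition a finite sum of finitely
  supported functions. The price is that the lamps outside \<open>B\<close> are still point masses,
  of neither kind; this is why the boundary of the cluster has to lie in \<open>B\<close>. Vectors
  from different windows and base points need not be orthogonal to each other. There are only
  countably many, so Gram-Schmidt can be run on all their eigenvectors inside the algebraic span,
  and linear algebra in finite dimension replaces the spectral theorem. The borderline case |H| = d
  is critical percolation, where the mean generation sizes do not decay; extinction then needs more
  than a first moment bound. For d = 1 the critical value is 1, and |H| \<ge> 2 keeps
  \<open>p\<close> below it.\<close>

lemma walk_Cons: "walk V E (x # p) \<longleftrightarrow> x \<in> V \<and> (p = [] \<or> {x, hd p} \<in> E \<and> walk V E p)"
proof (cases p)
  case Nil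
  then show ?thesis by (simp add: walk_def)
next
  case (Cons y q)
  have "(\<forall>i. Suc i < length (x # p) \<longrightarrow> {(x # p) ! i, (x # p) ! Suc i} \<in> E) \<longleftrightarrow>
        {x, y} \<in> E \<and> (\<forall>i. Suc i < length p \<longrightarrow> {p ! i, p ! Suc i} \<in> E)"
    using Cons by (auto simp: nth_Cons split: nat.split)
  then show ?thesis
    using Cons by (auto simp: walk_def)
qed

lemma walk_snoc: "walk V E (p @ [y]) \<longleftrightarrow> y \<in> V \<and> (p = [] \<or> {last p, y} \<in> E \<and> walk V E p)"
proof (induction p)
  case Nil
  then show ?case by (simp add: walk_def)
next
  case (Cons x p)
  show ?case
    using Cons.IH by (cases p) (auto simp: walk_Cons)
qed

locale rooted_tree =
  fixes V :: "'v set" and E :: "'v set set" and r :: 'v and d :: nat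
  assumes homogeneous: "homogeneous_tree (d + 1) V E" and root: "r \<in> V"
begin

lemma no_cycle: "\<not> graph_cycle V E p"
  using homogeneous by (simp add: homogeneous_tree_def is_tree_def)

definition neighbours :: "'v \<Rightarrow> 'v set" where
  "neighbours x = {y \<in> V. {x, y} \<in> E}"

lemma card_neighbours: "x \<in> V \<Longrightarrow> card (neighbours x) = d + 1"
  using homogeneous by (simp add: homogeneous_tree_def neighbours_def)

lemma finite_neighbours: "x \<in> V \<Longrightarrow> finite (neighbours x)"
  using card_neighbours[of x] by (intro card_ge_0_finite) simp

section \<open>Distance from the root and uniqueness of parents\<close>

primrec ball :: "nat \<Rightarrow> 'v set" where
  "ball 0 = {r}"
| "ball (Suc n) = ball n \<union> (\<Union>x\<in>ball n. neighbours x)"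

text \<open>The graph distance from \<open>r\<close>. Going through balls turns
  \<open>level x \<le> n\<close> into membership in a finite set.\<close>

definition level :: "'v \<Rightarrow> nat" where
  "level x = (LEAST n. x \<in> ball n)"

declare ball.simps(2) [simp del]

lemma ball_subset: "ball n \<subseteq> V"
  using root by (induction n) (auto simp: neighbours_def ball.simps(2))

lemma finite_ball: "finite (ball n)"
proof (induction n)
  case (Suc n)
  then show ?case using finite_neighbours ball_subset[of n] by (auto simp: ball.simps(2))
qed simp

lemma ball_mono: "m \<le> n \<Longrightarrow> ball m \<subseteq> ball n"
  by (rule lift_Suc_mono_le[of ball]) (auto simp: ball.simps(2))

lemma root_in_ball: "r \<in> ball n"
  using ball_mono[of 0 n] by simp

lemma in_some_ball:
  assumes "x \<in> V"
  shows "\<exists>n. x \<in> ball n"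
proof -
  have "walk V E p \<Longrightarrow> hd p = r \<Longrightarrow> \<exists>n. last p \<in> ball n" for p
  proof (induction p rule: rev_induct)
    case (snoc y p)
    show ?case
    proof (cases "p = []")
      case True
      then show ?thesis using snoc.prems by (auto intro!: exI[of _ 0])
    next
      case False
      then obtain n where "last p \<in> ball n"
        using snoc by (auto simp: walk_snoc)
      then have "y \<in> ball (Suc n)"
        using snoc.prems False by (auto simp: walk_snoc neighbours_def ball.simps(2))
      then show ?thesis by auto
    qed
  qed (simp add: walk_def)
  then show ?thesis
    using homogeneous root assms
    unfolding homogeneous_tree_def is_tree_def connected_graph_def by metis
qed

lemma in_ball_iff:
  assumes "x \<in> V"
  shows "x \<in> ball n \<longleftrightarrow> level x \<le> n"
proof
  show "x \<in> ball n \<Longrightarrow> level x \<le> n"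
    unfolding level_def by (rule Least_le)
next
  have "x \<in> ball (level x)"
    unfolding level_def using in_some_ball[OF assms] by (rule LeastI_ex)
  then show "level x \<le> n \<Longrightarrow> x \<in> ball n"
    using ball_mono by blast
qed

lemma level_0_iff: "x \<in> V \<Longrightarrow> level x = 0 \<longleftrightarrow> x = r"
  using in_ball_iff[of x 0] by auto

lemma level_neighbour:
  assumes "x \<in> V" "y \<in> V" "{x, y} \<in> E"
  shows "level y \<le> Suc (level x)"
proof -
  have "x \<in> ball (level x)" using assms in_ball_iff by simp
  then have "y \<in> ball (Suc (level x))" using assms by (auto simp: neighbours_def ball.simps(2))
  then show ?thesis using assms in_ball_iff by simp
qed

lemma parent_exists:
  assumes "y \<in> V" "level y = Suc n"
  obtains x where "x \<in> V" "level x = n" "{x, y} \<in> E"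
proof -
  have "y \<in> ball (Suc n)" "y \<notin> ball n" using assms in_ball_iff by auto
  then obtain x where x: "x \<in> ball n" "y \<in> neighbours x" by (auto simp: ball.simps(2))
  then have "x \<in> V" "{x, y} \<in> E" using ball_subset by (auto simp: neighbours_def)
  moreover have "level x \<le> n" using x \<open>x \<in> V\<close> in_ball_iff by blast
  moreover have "level y \<le> Suc (level x)" using level_neighbour calculation assms by blast
  ultimately show ?thesis using that[of x] assms by simp
qed

text \<open>Pass from both ends to parents until the two ancestral lines merge; the inner vertices
  have smaller level, which keeps the path simple. An edge or a common child at the upper ends would
  close it to a cycle, and \<open>q \<noteq> []\<close> makes that cycle longer than 2.\<close>

lemma path_through_lower_levels:
  assumes "x \<in> V" "y \<in> V" "level x = n" "level y = n" "x \<noteq> y"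
  shows "\<exists>q. q \<noteq> [] \<and> walk V E (x # q @ [y]) \<and> distinct (x # q @ [y]) \<and> (\<forall>z\<in>set q. level z < n)"
  using assms
proof (induction n arbitrary: x y)
  case 0
  then show ?case using level_0_iff by auto
next
  case (Suc n)
  obtain x' where x': "x' \<in> V" "level x' = n" "{x', x} \<in> E"
    using parent_exists Suc.prems by metis
  obtain y' where y': "y' \<in> V" "level y' = n" "{y', y} \<in> E"
    using parent_exists Suc.prems by metis
  show ?case
  proof (cases "x' = y'")
    case True
    then show ?thesis
      using x' y' Suc.prems
      by (intro exI[of _ "[x']"]) (auto simp: walk_Cons insert_commute)
  next
    case False
    then obtain q where q: "q \<noteq> []" "walk V E (x' # q @ [y'])" "distinct (x' # q @ [y'])"
      "\<forall>z\<in>set q. level z < n"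
      using Suc.IH[of x' y'] x' y' by auto
    let ?q = "x' # q @ [y']"
    have "\<forall>z\<in>set ?q. level z < Suc n" using q x' y' by auto
    moreover have "walk V E (?q @ [y])"
      using walk_snoc[of V E ?q y] q y' Suc.prems by simp
    then have "walk V E (x # ?q @ [y])"
      using walk_Cons[of V E x "?q @ [y]"] x' Suc.prems by (simp add: insert_commute)
    moreover have "x \<notin> set ?q" "y \<notin> set ?q"
      using calculation(1) Suc.prems by auto
    then have "distinct (x # ?q @ [y])"
      using q(3) Suc.prems by auto
    ultimately show ?thesis by (intro exI[of _ ?q]) simp
  qed
qed

text \<open>An edge inside a level closes the path through lower levels; a loop is already a cycle
  of length one.\<close>

lemma level_neighbour_neq:
  assumes "x \<in> V" "y \<in> V" "{x, y} \<in> E"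
  shows "level x \<noteq> level y"
proof
  assume eq: "level x = level y"
  show False
  proof (cases "x = y")
    case True
    then have "graph_cycle V E [x]" using assms by (simp add: graph_cycle_def walk_def)
    then show False using no_cycle by blast
  next
    case False
    then obtain q where q: "q \<noteq> []" "walk V E (x # q @ [y])" "distinct (x # q @ [y])"
      using path_through_lower_levels assms eq by metis
    then have "graph_cycle V E (x # q @ [y])"
      using assms by (cases q) (auto simp: graph_cycle_def insert_commute)
    then show False using no_cycle by blast
  qed
qed

text \<open>A common child of two different vertices closes the path through lower levels between
  them.\<close>

lemma parent_unique:
  assumes "x \<in> V" "y \<in> V" "z \<in> V" "level x = n" "level y = n" "level z = Suc n"
    and "{x, z} \<in> E" "{y, z} \<in> E"
  shows "x = y"
proof (rule ccontr)
  assume "x \<noteq> y"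
  then obtain q where q: "q \<noteq> []" "walk V E (x # q @ [y])" "distinct (x # q @ [y])"
    "\<forall>u\<in>set q. level u < n"
    using path_through_lower_levels[of x y n] assms by auto
  then have "walk V E ((x # q @ [y]) @ [z])"
    using walk_snoc[of V E "x # q @ [y]" z] assms by simp
  moreover have "distinct ((x # q @ [y]) @ [z])"
    using q assms by auto
  ultimately have "graph_cycle V E ((x # q @ [y]) @ [z])"
    using assms q(1) by (cases q) (auto simp: graph_cycle_def insert_commute)
  then show False using no_cycle by blast
qed

text \<open>Generation \<open>n\<close> of the open cluster of \<open>r\<close>, seen as a branching
  process: open vertices joined to \<open>r\<close> by open vertices of increasing level.\<close>

primrec reached :: "nat \<Rightarrow> 'v set \<Rightarrow> 'v set" where
  "reached 0 D = {r} \<inter> D"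
| "reached (Suc n) D = {y \<in> D. y \<in> V \<and> level y = Suc n \<and> (\<exists>x\<in>reached n D. {x, y} \<in> E)}"

lemma reached_subset: "reached n D \<subseteq> {x \<in> D. x \<in> V \<and> level x = n}"
  using root level_0_iff[of r] by (cases n) auto

lemma finite_reached: "finite (reached n D)"
proof -
  have "reached n D \<subseteq> ball n" using reached_subset[of n D] in_ball_iff by auto
  then show ?thesis using finite_ball finite_subset by blast
qed

text \<open>Generation \<open>n\<close> is determined by the sites in \<open>ball n\<close>, so
  opening sites further out leaves it unchanged.\<close>

lemma reached_Un:
  "D' \<inter> ball n = {} \<Longrightarrow> reached n (D \<union> D') = reached n D"
proof (induction n)
  case (Suc n)
  have "D' \<inter> ball n = {}" using Suc.prems by (auto simp: ball.simps(2))
  moreover have "y \<notin> D'" if "y \<in> V" "level y = Suc n" for y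
    using Suc.prems in_ball_iff[of y "Suc n"] that by auto
  ultimately show ?case using Suc.IH by auto
qed auto

end

text \<open>
  The configuration \<open>D\<close> of open vertices in the window \<open>B\<close> is confined if the open cluster
  of \<open>r\<close> is empty or has all its outer boundary in \<open>B\<close>.
\<close>

definition confined :: "'v set \<Rightarrow> 'v set set \<Rightarrow> 'v \<Rightarrow> 'v set \<Rightarrow> 'v set \<Rightarrow> bool" where
  "confined V E r B D \<longleftrightarrow>
     r \<notin> D \<or> (\<exists>C\<subseteq>D. r \<in> C \<and> (\<forall>x\<in>C. \<forall>y\<in>V. {x, y} \<in> E \<longrightarrow> y \<in> C \<union> (B - D)))"

text \<open>The generations below \<open>n\<close> form the cluster. A neighbour one level up is
  reached or closed, and in both cases lies in \<open>ball n\<close>; a neighbour one level down is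
  the unique parent, which was reached before.\<close>

lemma (in rooted_tree) confined_if_unreached:
  assumes "reached n D = {}"
  shows "confined V E r (ball n) D"
proof (cases "r \<in> D")
  case True
  let ?C = "\<Union>k<n. reached k D"
  have "n \<noteq> 0" using assms True by (cases n) auto
  then have "r \<in> reached 0 D" "0 < n" using True by auto
  then have "r \<in> ?C" by blast
  moreover have "?C \<subseteq> D" using reached_subset by blast
  moreover have step: "y \<in> ?C \<union> (ball n - D)"
    if k: "k < n" and x: "x \<in> reached k D" and y: "y \<in> V" "{x, y} \<in> E" for k x y
  proof -
    have xV: "x \<in> V" and lx: "level x = k" using x reached_subset by blast+
    have "level y \<le> Suc k" "level y \<noteq> k" "k \<le> Suc (level y)"
      using level_neighbour[of x y] level_neighbour[of y x] level_neighbour_neq[of x y] xV y lx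
      by (auto simp: insert_commute)
    then consider "level y = Suc k" | "k = Suc (level y)" by linarith
    then show ?thesis
    proof cases
      case 1
      show ?thesis
      proof (cases "y \<in> D")
        case True
        then have r: "y \<in> reached (Suc k) D" using 1 x y by auto
        \<comment> \<open>The case \<open>Suc k = n\<close> is excluded because generation
          \<open>n\<close> is empty.\<close>
        then have "Suc k < n" using assms k by (metis Suc_lessI empty_iff)
        then show ?thesis using r by blast
      next
        case False
        then show ?thesis using 1 k y in_ball_iff by auto
      qed
    next
      case 2
      then obtain x' where x': "x' \<in> reached (level y) D" "{x', x} \<in> E" using x by auto
      then have "x' \<in> V" "level x' = level y" using reached_subset by blast+
      \<comment> \<open>Both \<open>y\<close> and the vertex \<open>x'\<close> from which
        \<open>x\<close> was reached are parents of \<open>x\<close>.\<close>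
      then have "x' = y"
        using parent_unique[of x' y x "level y"] x' xV lx y 2 by (simp add: insert_commute)
      then have "y \<in> reached (level y) D" "level y < n" using x'(1) 2 k by auto
      then show ?thesis by blast
    qed
  qed
  moreover have "\<forall>x\<in>?C. \<forall>y\<in>V. {x, y} \<in> E \<longrightarrow> y \<in> ?C \<union> (ball n - D)"
  proof (intro ballI impI)
    fix x y assume "x \<in> ?C" "y \<in> V" "{x, y} \<in> E"
    then obtain k where "k < n" "x \<in> reached k D" by blast
    then show "y \<in> ?C \<union> (ball n - D)" using step \<open>y \<in> V\<close> \<open>{x, y} \<in> E\<close> by metis
  qed
  ultimately show ?thesis unfolding confined_def by (intro disjI2 exI[of _ ?C] conjI)
qed (simp add: confined_def)

section \<open>Bernoulli percolation in finite windows\<close>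

definition bernoulli_weight :: "real \<Rightarrow> 'v set \<Rightarrow> 'v set \<Rightarrow> real" where
  "bernoulli_weight p B D = p ^ card D * (1 - p) ^ card (B - D)"

definition bernoulli_mean :: "real \<Rightarrow> 'v set \<Rightarrow> ('v set \<Rightarrow> real) \<Rightarrow> real" where
  "bernoulli_mean p B f = (\<Sum>D\<in>Pow B. bernoulli_weight p B D * f D)"

lemma bernoulli_mean_cong:
  "(\<And>D. D \<subseteq> B \<Longrightarrow> f D = g D) \<Longrightarrow> bernoulli_mean p B f = bernoulli_mean p B g"
  by (simp add: bernoulli_mean_def)

lemma bernoulli_mean_mono:
  assumes "0 \<le> p" "p \<le> 1" "\<And>D. D \<subseteq> B \<Longrightarrow> f D \<le> g D"
  shows "bernoulli_mean p B f \<le> bernoulli_mean p B g"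
  unfolding bernoulli_mean_def
  using assms by (intro sum_mono mult_left_mono) (auto simp: bernoulli_weight_def)

lemma bernoulli_mean_add:
  "bernoulli_mean p B (\<lambda>D. f D + g D) = bernoulli_mean p B f + bernoulli_mean p B g"
  by (simp add: bernoulli_mean_def sum.distrib distrib_left)

lemma bernoulli_mean_diff:
  "bernoulli_mean p B (\<lambda>D. f D - g D) = bernoulli_mean p B f - bernoulli_mean p B g"
  by (simp add: bernoulli_mean_def sum_subtractf right_diff_distrib)

lemma bernoulli_mean_cmult:
  "bernoulli_mean p B (\<lambda>D. c * f D) = c * bernoulli_mean p B f"
  by (simp add: bernoulli_mean_def sum_distrib_left mult.left_commute)

lemma bernoulli_mean_sum:
  "bernoulli_mean p B (\<lambda>D. \<Sum>i\<in>I. f i D) = (\<Sum>i\<in>I. bernoulli_mean p B (f i))"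
  unfolding bernoulli_mean_def sum_distrib_left by (rule sum.swap)

text \<open>Expanding the product of the factors \<open>p + (1 - p)\<close> over subsets shows that
  the weights sum to 1.\<close>

lemma bernoulli_mean_const:
  assumes "finite B"
  shows "bernoulli_mean p B (\<lambda>_. c) = c"
proof -
  have "(\<Sum>D\<in>Pow B. bernoulli_weight p B D) = (\<Prod>x\<in>B. p + (1 - p))"
    using prod_add[OF assms, of "\<lambda>_. p" "\<lambda>_. 1 - p"] by (simp add: bernoulli_weight_def)
  then show ?thesis
    by (simp add: bernoulli_mean_def flip: sum_distrib_right)
qed

text \<open>Independence of disjoint windows: the weight is multiplicative, so the mean is an
  iterated mean.\<close>

lemma bernoulli_mean_Un:
  assumes "finite B" "finite S" "B \<inter> S = {}"
  shows "bernoulli_mean p (B \<union> S) f =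
    bernoulli_mean p B (\<lambda>D. bernoulli_mean p S (\<lambda>D'. f (D \<union> D')))"
proof -
  have wt: "bernoulli_weight p (B \<union> S) (D \<union> D') = bernoulli_weight p B D * bernoulli_weight p S D'"
    if "D \<subseteq> B" "D' \<subseteq> S" for D D'
  proof -
    have fin: "finite D" "finite D'" using that assms by (auto intro: finite_subset)
    have "card (D \<union> D') = card D + card D'"
      using that assms fin by (intro card_Un_disjoint) auto
    moreover have "B \<union> S - (D \<union> D') = (B - D) \<union> (S - D')" using that assms by auto
    moreover have "card ((B - D) \<union> (S - D')) = card (B - D) + card (S - D')"
      using assms by (intro card_Un_disjoint) auto
    ultimately show ?thesis by (simp add: bernoulli_weight_def power_add)
  qed
  have "bernoulli_mean p (B \<union> S) f =
    (\<Sum>(D, D')\<in>Pow B \<times> Pow S. bernoulli_weight p B D * (bernoulli_weight p S D' * f (D \<union> D')))"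
    unfolding bernoulli_mean_def
  proof (rule sum.reindex_bij_witness[of _ "\<lambda>(D, D'). D \<union> D'" "\<lambda>D. (D \<inter> B, D \<inter> S)"])
    fix D assume "D \<in> Pow (B \<union> S)"
    then have "D = D \<inter> B \<union> D \<inter> S" by auto
    then show "(case (D \<inter> B, D \<inter> S) of (D, D') \<Rightarrow>
        bernoulli_weight p B D * (bernoulli_weight p S D' * f (D \<union> D'))) =
      bernoulli_weight p (B \<union> S) D * f D"
      using wt[of "D \<inter> B" "D \<inter> S"] by simp
  qed (use assms in auto)
  also have "\<dots> = bernoulli_mean p B (\<lambda>D. bernoulli_mean p S (\<lambda>D'. f (D \<union> D')))"
    using assms by (simp add: bernoulli_mean_def sum_distrib_left flip: sum.cartesian_product)
  finally show ?thesis .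
qed

lemma bernoulli_mean_avoid:
  assumes "finite S" "N \<subseteq> S"
  shows "bernoulli_mean p S (\<lambda>D. of_bool (D \<inter> N = {})) = (1 - p) ^ card N"
proof -
  have fin: "finite N" "finite (S - N)" using assms finite_subset by auto
  have S: "S = N \<union> (S - N)" using assms by auto
  have "bernoulli_mean p S (\<lambda>D. of_bool (D \<inter> N = {})) =
    bernoulli_mean p N (\<lambda>D. bernoulli_mean p (S - N) (\<lambda>D'. of_bool ((D \<union> D') \<inter> N = {})))"
    by (subst S, rule bernoulli_mean_Un) (use fin in auto)
  also have "\<dots> = bernoulli_mean p N (\<lambda>D. of_bool (D = {}))"
  proof (rule bernoulli_mean_cong)
    fix D assume "D \<subseteq> N"
    then have "bernoulli_mean p (S - N) (\<lambda>D'. of_bool ((D \<union> D') \<inter> N = {})) =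
        bernoulli_mean p (S - N) (\<lambda>_. of_bool (D = {}))"
      by (intro bernoulli_mean_cong arg_cong[of _ _ of_bool]) auto
    then show "bernoulli_mean p (S - N) (\<lambda>D'. of_bool ((D \<union> D') \<inter> N = {})) = of_bool (D = {})"
      using bernoulli_mean_const[OF fin(2)] by simp
  qed
  also have "\<dots> = (\<Sum>D\<in>{{}}. bernoulli_weight p N D * of_bool (D = {}))"
    unfolding bernoulli_mean_def using fin by (intro sum.mono_neutral_right) auto
  finally show ?thesis by (simp add: bernoulli_weight_def)
qed

text \<open>Linearity of the mean, with the event that \<open>x\<close> is open written as the
  complement of avoiding \<open>{x}\<close>.\<close>

lemma bernoulli_mean_card:
  assumes "finite S" "N \<subseteq> S"
  shows "bernoulli_mean p S (\<lambda>D. real (card (D \<inter> N))) = p * card N"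
proof -
  have fin: "finite N" using assms finite_subset by auto
  have "real (card (D \<inter> N)) = (\<Sum>x\<in>N. 1 - of_bool (D \<inter> {x} = {}))" for D
  proof -
    have "(\<Sum>x\<in>N. 1 - of_bool (D \<inter> {x} = {})) = (\<Sum>x\<in>N. if x \<in> D then 1 else 0 :: real)"
      by (intro sum.cong) auto
    then show ?thesis using fin by (simp add: sum.If_cases Int_commute)
  qed
  moreover have "bernoulli_mean p S (\<lambda>D. 1 - of_bool (D \<inter> {x} = {})) = p" if "x \<in> N" for x
    using that assms bernoulli_mean_avoid[of S "{x}" p]
    by (subst bernoulli_mean_diff) (auto simp: bernoulli_mean_const)
  ultimately show ?thesis
    by (simp add: bernoulli_mean_sum)
qed

section \<open>Percolation on the tree as a branching process\<close>

context rooted_tree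
begin

definition children :: "'v set \<Rightarrow> nat \<Rightarrow> 'v set" where
  "children W n = {y \<in> V. level y = Suc n \<and> (\<exists>x\<in>W. {x, y} \<in> E)}"

text \<open>Away from the root, one of the \<open>d + 1\<close> neighbours is the parent and hence
  no child. The root has no parent, whence the weaker first bound.\<close>

lemma card_children:
  assumes "W \<subseteq> {x \<in> V. level x = n}" "finite W"
  shows "card (children W n) \<le> (d + 1) * card W" "n \<noteq> 0 \<Longrightarrow> card (children W n) \<le> d * card W"
proof -
  have sub: "children W n = (\<Union>x\<in>W. {y \<in> neighbours x. level y = Suc n})"
    unfolding children_def neighbours_def by auto
  have UN: "card (children W n) \<le> (\<Sum>x\<in>W. card {y \<in> neighbours x. level y = Suc n})"
    unfolding sub using assms(2) by (rule card_UN_le)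
  have "card {y \<in> neighbours x. level y = Suc n} \<le> d + 1" if "x \<in> W" for x
    using that assms card_mono[of "neighbours x" "{y \<in> neighbours x. level y = Suc n}"]
      finite_neighbours[of x] card_neighbours[of x] by auto
  then have "(\<Sum>x\<in>W. card {y \<in> neighbours x. level y = Suc n}) \<le> card W * (d + 1)"
    using sum_bounded_above[of W "\<lambda>x. card {y \<in> neighbours x. level y = Suc n}" "d + 1"] by simp
  then show "card (children W n) \<le> (d + 1) * card W" using UN by (simp add: mult.commute)
  assume "n \<noteq> 0"
  have "card {y \<in> neighbours x. level y = Suc n} \<le> d" if "x \<in> W" for x
  proof -
    have x: "x \<in> V" "level x = n" using that assms by auto
    then obtain z where z: "z \<in> V" "level z = n - 1" "{z, x} \<in> E"
      using parent_exists[of x "n - 1"] \<open>n \<noteq> 0\<close> by auto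
    have "{y \<in> neighbours x. level y = Suc n} \<subset> neighbours x"
    proof
      have "z \<in> neighbours x" "z \<notin> {y \<in> neighbours x. level y = Suc n}"
        using z by (auto simp: neighbours_def insert_commute)
      then show "{y \<in> neighbours x. level y = Suc n} \<noteq> neighbours x" by blast
    qed blast
    then have "card {y \<in> neighbours x. level y = Suc n} < card (neighbours x)"
      using finite_neighbours[OF x(1)] by (rule psubset_card_mono[rotated])
    then show ?thesis using card_neighbours[OF x(1)] by simp
  qed
  then have "(\<Sum>x\<in>W. card {y \<in> neighbours x. level y = Suc n}) \<le> card W * d"
    using sum_bounded_above[of W "\<lambda>x. card {y \<in> neighbours x. level y = Suc n}" d] by simp
  then show "card (children W n) \<le> d * card W" using UN by (simp add: mult.commute)
qed

text \<open>The Markov property: given the sites in \<open>ball n\<close>, the next generation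
  consists of the open sites among the children of generation \<open>n\<close>, and these all lie in
  the new sphere.\<close>

lemma bernoulli_mean_reached_Suc:
  "bernoulli_mean p (ball (Suc n)) (\<lambda>D. f (reached (Suc n) D)) =
   bernoulli_mean p (ball n) (\<lambda>D. bernoulli_mean p (ball (Suc n) - ball n)
      (\<lambda>D'. f (D' \<inter> children (reached n D) n)))"
proof -
  have B: "ball (Suc n) = ball n \<union> (ball (Suc n) - ball n)" using ball_mono[of n "Suc n"] by auto
  have "reached (Suc n) (D \<union> D') = D' \<inter> children (reached n D) n"
    if "D \<subseteq> ball n" "D' \<subseteq> ball (Suc n) - ball n" for D D'
  proof -
    have "reached n (D \<union> D') = reached n D" using that by (intro reached_Un) auto
    moreover have "level y \<noteq> Suc n" if "y \<in> D" "y \<in> V" for y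
      using that \<open>D \<subseteq> ball n\<close> in_ball_iff[of y n] by auto
    ultimately show ?thesis by (auto simp: children_def)
  qed
  then show ?thesis
    by (subst B, subst bernoulli_mean_Un)
      (auto intro!: bernoulli_mean_cong simp: finite_ball simp del: reached.simps)
qed

lemma children_subset: "children W n \<subseteq> ball (Suc n) - ball n"
  using in_ball_iff by (auto simp: children_def)

text \<open>Generation 0 has at most one vertex. The root contributes a factor
  \<open>p * (d + 1) \<le> 2\<close>, because \<open>d * p \<le> 1\<close> and
  \<open>p \<le> 1\<close>; each later generation contributes a factor
  \<open>d * p \<le> 1\<close>.\<close>

lemma mean_reached_bound:
  fixes p :: real
  assumes p: "0 \<le> p" "p \<le> 1" "d * p \<le> 1"
  shows "bernoulli_mean p (ball n) (\<lambda>D. real (card (reached n D))) \<le> 2"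
proof (induction n)
  case 0
  have "bernoulli_mean p {r} (\<lambda>D. real (card ({r} \<inter> D))) \<le> bernoulli_mean p {r} (\<lambda>_. 1)"
    using p by (intro bernoulli_mean_mono) (auto simp: Int_insert_left)
  then show ?case using bernoulli_mean_const[of "{r}" p 1] by simp
next
  case (Suc n)
  let ?m = "\<lambda>n. bernoulli_mean p (ball n) (\<lambda>D. real (card (reached n D)))"
  have step: "?m (Suc n) \<le> p * k * ?m n"
    if k: "\<And>D. card (children (reached n D) n) \<le> k * card (reached n D)" for k :: nat
  proof -
    have "?m (Suc n) = bernoulli_mean p (ball n) (\<lambda>D. p * card (children (reached n D) n))"
      unfolding bernoulli_mean_reached_Suc[of p n "\<lambda>W. real (card W)"]
      using children_subset finite_ball
      by (intro bernoulli_mean_cong bernoulli_mean_card) auto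
    also have "\<dots> \<le> bernoulli_mean p (ball n) (\<lambda>D. p * k * card (reached n D))"
    proof (rule bernoulli_mean_mono)
      fix D
      have "real (card (children (reached n D) n)) \<le> real k * real (card (reached n D))"
        using k[of D] by (metis of_nat_le_iff of_nat_mult)
      then show "p * real (card (children (reached n D) n)) \<le> p * k * card (reached n D)"
        using p by (simp add: mult.assoc mult_left_mono)
    qed (use p in auto)
    finally show ?thesis by (simp add: bernoulli_mean_cmult)
  qed
  have W: "reached n D \<subseteq> {x \<in> V. level x = n}" for D using reached_subset[of n D] by auto
  show ?case
  proof (cases "n = 0")
    case True
    have "?m 0 \<le> bernoulli_mean p (ball 0) (\<lambda>_. 1)"
      using p by (intro bernoulli_mean_mono) (auto simp: Int_insert_left)
    then have m0: "?m 0 \<le> 1" using bernoulli_mean_const[of "ball 0" p 1] by simp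
    have "?m (Suc n) \<le> p * real (d + 1) * ?m n"
      using step card_children(1)[OF W finite_reached] by blast
    also have "\<dots> \<le> p * real (d + 1) * 1"
      using m0 p True by (intro mult_left_mono) auto
    also have "\<dots> \<le> 2" using p by (simp add: algebra_simps)
    finally show ?thesis .
  next
    case False
    have "0 \<le> bernoulli_mean p (ball n) (\<lambda>D. 0)" by (simp add: bernoulli_mean_def)
    also have "\<dots> \<le> ?m n" using p by (intro bernoulli_mean_mono) auto
    finally have m: "0 \<le> ?m n" .
    have "?m (Suc n) \<le> p * real d * ?m n"
      using step card_children(2)[OF W finite_reached False] by blast
    also have "\<dots> \<le> 1 * ?m n"
      using m p by (intro mult_right_mono) (auto simp: mult.commute)
    finally show ?thesis using Suc by simp
  qed
qed

text \<open>
  If at most \<open>K\<close> vertices of level \<open>n\<close> are reached, the percolation stops there with a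
  probability bounded below in terms of \<open>K\<close>; more than \<open>K\<close> reached vertices are unlikely because
  the mean number is bounded. So the survival probabilities cannot have a positive limit.
\<close>

lemma survival_step:
  fixes p :: real
  assumes p: "0 \<le> p" "p < 1" "d * p \<le> 1"
  defines "a \<equiv> \<lambda>n. bernoulli_mean p (ball n) (\<lambda>D. of_bool (reached n D \<noteq> {}))"
  shows "a n \<le> (a n - a (Suc n)) / (1 - p) ^ ((d + 1) * K) + 2 / (real K + 1)"
proof -
  \<comment> \<open>The reciprocal of a lower bound for the probability that all children of at most
    \<open>K\<close> vertices are closed; \<open>d + 1\<close> children per vertex also cover the
    root.\<close>
  define c where "c = 1 / (1 - p) ^ ((d + 1) * K)"
  have c: "c > 0" using p by (simp add: c_def)
  let ?N = "\<lambda>D. children (reached n D) n"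
  have "a (Suc n) = bernoulli_mean p (ball n) (\<lambda>D. 1 - (1 - p) ^ card (?N D))"
    unfolding a_def bernoulli_mean_reached_Suc[of p n "\<lambda>W. of_bool (W \<noteq> {})"]
  proof (rule bernoulli_mean_cong)
    fix D
    have "bernoulli_mean p (ball (Suc n) - ball n) (\<lambda>D'. of_bool (D' \<inter> ?N D \<noteq> {})) =
      bernoulli_mean p (ball (Suc n) - ball n) (\<lambda>D'. 1 - of_bool (D' \<inter> ?N D = {}))"
      by (rule bernoulli_mean_cong) auto
    then show "bernoulli_mean p (ball (Suc n) - ball n) (\<lambda>D'. of_bool (D' \<inter> ?N D \<noteq> {})) =
        1 - (1 - p) ^ card (?N D)"
      using bernoulli_mean_avoid[OF _ children_subset[of "reached n D" n], of p] finite_ball[of "Suc n"]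
      by (simp add: bernoulli_mean_diff bernoulli_mean_const)
  qed
  then have diff: "a n - a (Suc n) =
      bernoulli_mean p (ball n) (\<lambda>D. of_bool (reached n D \<noteq> {}) - (1 - (1 - p) ^ card (?N D)))"
    by (simp add: a_def bernoulli_mean_diff)
  have "a n \<le> bernoulli_mean p (ball n) (\<lambda>D. c * (of_bool (reached n D \<noteq> {}) - (1 - (1 - p) ^ card (?N D)))
      + 1 / (real K + 1) * card (reached n D))"
    unfolding a_def
  proof (rule bernoulli_mean_mono)
    fix D
    let ?W = "reached n D"
    show "of_bool (?W \<noteq> {}) \<le> c * (of_bool (?W \<noteq> {}) - (1 - (1 - p) ^ card (?N D)))
      + 1 / (real K + 1) * card ?W"
    proof (cases "?W = {}")
      case True
      then show ?thesis by (simp add: children_def)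
    next
      case False
      have c1: "0 \<le> c * (1 - p) ^ card (?N D)" using c p by simp
      show ?thesis
      proof (cases "card ?W \<le> K")
        case True
        have "card (?N D) \<le> (d + 1) * card ?W"
          using reached_subset[of n D] finite_reached by (intro card_children) auto
        also have "\<dots> \<le> (d + 1) * K" using True by (intro mult_le_mono2)
        finally have "(1 - p) ^ ((d + 1) * K) \<le> (1 - p) ^ card (?N D)"
          using p by (intro power_decreasing) auto
        then have "1 \<le> c * (1 - p) ^ card (?N D)" using p by (simp add: c_def)
        then show ?thesis using False by (simp add: add_increasing2)
      next
        case large: False
        then have "1 \<le> 1 / (K + 1) * real (card ?W)" by (simp add: field_simps)
        then show ?thesis using False c1 by (simp add: add_increasing)
      qed
    qed
  qed (use p in auto)
  also have "\<dots> = c * (a n - a (Suc n)) +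
      1 / (real K + 1) * bernoulli_mean p (ball n) (\<lambda>D. card (reached n D))"
    by (simp only: bernoulli_mean_add bernoulli_mean_cmult diff)
  also have "\<dots> \<le> c * (a n - a (Suc n)) + 1 / (real K + 1) * 2"
    using mean_reached_bound[of p n] p by (intro add_left_mono mult_left_mono) auto
  finally show ?thesis by (simp add: c_def)
qed

theorem percolation_dies_out:
  fixes p :: real
  assumes p: "0 \<le> p" "p < 1" "d * p \<le> 1" and "0 < \<epsilon>"
  shows "\<exists>B. finite B \<and> B \<subseteq> V \<and> r \<in> B \<and>
    (\<Sum>D | D \<subseteq> B \<and> \<not> confined V E r B D. bernoulli_weight p B D) < \<epsilon>"
proof -
  define a where "a = (\<lambda>n. bernoulli_mean p (ball n) (\<lambda>D. of_bool (reached n D \<noteq> {})))"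
  have "\<exists>n. a n < \<epsilon>"
  proof (rule ccontr)
    assume "\<nexists>n. a n < \<epsilon>"
    then have ge: "\<epsilon> \<le> a n" for n by (simp add: not_less)
    \<comment> \<open>This \<open>K\<close> makes the Markov term at most half of the supposed lower
      bound \<epsilon>; the other half must come from the decrease of \<open>a\<close>.\<close>
    obtain K :: nat where "4 / \<epsilon> < K" using reals_Archimedean2 by blast
    then have K: "2 / (real K + 1) < \<epsilon> / 2" using \<open>0 < \<epsilon>\<close> by (simp add: field_simps)
    define c where "c = (1 - p) ^ ((d + 1) * K)"
    have "0 < c" using p by (simp add: c_def)
    have "a n \<le> (a n - a (Suc n)) / c + 2 / (real K + 1)" for n
      unfolding a_def c_def by (rule survival_step[OF p])
    then have "\<epsilon> / 2 < (a n - a (Suc n)) / c" for n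
      using ge[of n] K by (smt (verit) field_sum_of_halves)
    then have step: "a (Suc n) \<le> a n - c * \<epsilon> / 2" for n
      using \<open>0 < c\<close> by (smt (verit) pos_less_divide_eq mult.commute times_divide_eq_right)
    \<comment> \<open>The decrease per level is bounded below by a constant, so \<open>a n\<close>
      would eventually be negative.\<close>
    have "a n \<le> a 0 - n * (c * \<epsilon> / 2)" for n
    proof (induction n)
      case (Suc n)
      then show ?case using step[of n] by (simp add: ring_distribs add_divide_distrib mult_ac)
    qed simp
    moreover obtain n :: nat where "a 0 < n * (c * \<epsilon> / 2)"
      using reals_Archimedean3[of "c * \<epsilon> / 2"] \<open>0 < c\<close> \<open>0 < \<epsilon>\<close> by auto
    ultimately have "a n < 0" by (meson diff_less_0_iff_less le_less_trans)
    then show False using ge[of n] \<open>0 < \<epsilon>\<close> by linarith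
  qed
  then obtain n where n: "a n < \<epsilon>" by blast
  have "(\<Sum>D | D \<subseteq> ball n \<and> \<not> confined V E r (ball n) D. bernoulli_weight p (ball n) D) \<le>
      (\<Sum>D | D \<subseteq> ball n \<and> reached n D \<noteq> {}. bernoulli_weight p (ball n) D)"
    using confined_if_unreached finite_ball p
    by (intro sum_mono2) (auto simp: bernoulli_weight_def)
  also have "\<dots> = a n"
    unfolding a_def bernoulli_mean_def using finite_ball
    by (intro sum.mono_neutral_cong_left) auto
  finally show ?thesis
    using n finite_ball ball_subset root_in_ball by (intro exI[of _ "ball n"]) auto
qed

end

section \<open>Symmetric operators with finite-dimensional invariant subspaces\<close>

text \<open>Stated for an indexed family because the iterates \<open>(T ^^ k) v\<close> may repeat,
  and a set would not see the repetition. A repeated vector is itself a relation, with coefficients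
  1 and -1.\<close>

lemma (in vector_space) family_dependent:
  assumes "finite t" "\<And>k. k \<le> card t \<Longrightarrow> f k \<in> span t"
  shows "\<exists>a. (\<exists>k\<le>card t. a k \<noteq> 0) \<and> (\<Sum>k\<le>card t. scale (a k) (f k)) = 0"
proof (cases "inj_on f {..card t}")
  case True
  have "dependent (f ` {..card t})"
  proof (rule ccontr)
    assume "independent (f ` {..card t})"
    then have "card (f ` {..card t}) \<le> card t"
      using independent_span_bound[OF assms(1), of "f ` {..card t}"] assms(2) by auto
    then show False using True by (simp add: card_image)
  qed
  then obtain u where u: "\<exists>v\<in>f ` {..card t}. u v \<noteq> 0" "(\<Sum>v\<in>f ` {..card t}. scale (u v) v) = 0"
    using dependent_finite[of "f ` {..card t}"] by auto
  then show ?thesis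
    using True by (intro exI[of _ "\<lambda>k. u (f k)"]) (auto simp: sum.reindex)
next
  case False
  then obtain i j where ij: "i \<le> card t" "j \<le> card t" "i \<noteq> j" "f i = f j"
    by (auto simp: inj_on_def)
  define a where "a = (\<lambda>k. if k = i then 1 else if k = j then - 1 else 0 :: 'a)"
  have "(\<Sum>k\<le>card t. scale (a k) (f k)) = (\<Sum>k\<in>{i, j}. scale (a k) (f k))"
    using ij by (intro sum.mono_neutral_right) (auto simp: a_def)
  also have "\<dots> = 0" using ij by (simp add: a_def)
  finally show ?thesis using ij by (intro exI[of _ a]) (auto simp: a_def)
qed

text \<open>The inner product laws are asked only on \<open>U\<close>, which will be the finitely
  supported functions: there \<open>ell2_inner\<close> is a finite sum and no convergence has to be
  discussed. Completeness of \<open>U\<close> is replaced by finite-dimensional arguments.\<close>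

locale symmetric_operator = vector_space scale
  for scale :: "complex \<Rightarrow> 'v::ab_group_add \<Rightarrow> 'v" (infixr \<open>*s\<close> 75) +
  fixes ip :: "'v \<Rightarrow> 'v \<Rightarrow> complex" and T :: "'v \<Rightarrow> 'v" and U :: "'v set"
  assumes subspace_U: "subspace U"
    and ip_add: "\<lbrakk>x \<in> U; y \<in> U; z \<in> U\<rbrakk> \<Longrightarrow> ip (x + y) z = ip x z + ip y z"
    and ip_scale: "\<lbrakk>x \<in> U; z \<in> U\<rbrakk> \<Longrightarrow> ip (c *s x) z = c * ip x z"
    and ip_commute: "\<lbrakk>x \<in> U; y \<in> U\<rbrakk> \<Longrightarrow> ip y x = cnj (ip x y)"
    and ip_pos: "\<lbrakk>x \<in> U; x \<noteq> 0\<rbrakk> \<Longrightarrow> \<exists>r>0. ip x x = complex_of_real r"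
    and T_add: "T (x + y) = T x + T y"
    and T_scale: "T (c *s x) = c *s T x"
    and T_closed: "x \<in> U \<Longrightarrow> T x \<in> U"
    and T_symmetric: "\<lbrakk>x \<in> U; y \<in> U\<rbrakk> \<Longrightarrow> ip (T x) y = ip x (T y)"
begin

lemma T_0: "T 0 = 0"
  using T_scale[of 0 0] by simp

lemma T_diff: "T (x - y) = T x - T y"
  using T_add[of "x - y" y] by (simp add: algebra_simps)

lemma T_sum: "T (\<Sum>i\<in>I. f i) = (\<Sum>i\<in>I. T (f i))"
  by (induction I rule: infinite_finite_induct) (auto simp: T_0 T_add)

lemma ip_0_left: "z \<in> U \<Longrightarrow> ip 0 z = 0"
  using ip_scale[of 0 z 0] subspace_0[OF subspace_U] by simp

lemma ip_diff: "\<lbrakk>x \<in> U; y \<in> U; z \<in> U\<rbrakk> \<Longrightarrow> ip (x - y) z = ip x z - ip y z"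
  using ip_add[of "x - y" y z] subspace_diff[OF subspace_U] by simp

lemma ip_sum: "\<lbrakk>\<And>i. i \<in> I \<Longrightarrow> f i \<in> U; z \<in> U\<rbrakk> \<Longrightarrow> ip (\<Sum>i\<in>I. f i) z = (\<Sum>i\<in>I. ip (f i) z)"
proof (induction I rule: infinite_finite_induct)
  case (insert i I)
  then show ?case using ip_add[of "f i" "\<Sum>i\<in>I. f i" z] subspace_sum[OF subspace_U, of I f] by simp
qed (auto simp: ip_0_left)

lemma ip_scale_right: "\<lbrakk>x \<in> U; z \<in> U\<rbrakk> \<Longrightarrow> ip x (c *s z) = cnj c * ip x z"
  using ip_commute[of "c *s z" x] ip_commute[of z x] ip_scale[of z x c]
    subspace_scale[OF subspace_U, of z c] by simp

lemma ip_self_nonzero: "\<lbrakk>x \<in> U; x \<noteq> 0\<rbrakk> \<Longrightarrow> ip x x \<noteq> 0"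
  using ip_pos by fastforce

definition eigen :: "complex \<Rightarrow> 'v \<Rightarrow> bool" where
  "eigen c x \<longleftrightarrow> x \<in> U \<and> x \<noteq> 0 \<and> T x = c *s x"

lemma eigen_value_real:
  assumes "eigen c x"
  shows "cnj c = c"
proof -
  have "c * ip x x = cnj c * ip x x"
    using assms T_symmetric[of x x] ip_scale[of x x c] ip_scale_right[of x x c] by (simp add: eigen_def)
  then show ?thesis using assms ip_self_nonzero[of x] by (auto simp: eigen_def)
qed

lemma eigen_orthogonal:
  assumes "eigen c x" "eigen c' y" "c \<noteq> c'"
  shows "ip x y = 0"
proof -
  have "c * ip x y = c' * ip x y"
    using assms T_symmetric[of x y] ip_scale[of x y c] ip_scale_right[of x y c'] eigen_value_real[of c' y]
    by (simp add: eigen_def)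
  then show ?thesis using assms(3) by simp
qed

text \<open>The vector p(T) v, evaluated by Horner's scheme.\<close>

definition apply_poly :: "complex poly \<Rightarrow> 'v \<Rightarrow> 'v" where
  "apply_poly p v = fold_coeffs (\<lambda>a w. a *s v + T w) p 0"

lemma apply_poly_0 [simp]: "apply_poly 0 v = 0"
  by (simp add: apply_poly_def)

lemma apply_poly_pCons [simp]: "apply_poly (pCons a p) v = a *s v + T (apply_poly p v)"
  by (cases "p = 0 \<and> a = 0") (auto simp: apply_poly_def T_0)

lemma apply_poly_add: "apply_poly (p + q) v = apply_poly p v + apply_poly q v"
  by (induction p q rule: poly_induct2) (auto simp: T_add scale_left_distrib)

lemma apply_poly_smult: "apply_poly (smult c p) v = c *s apply_poly p v"
  by (induction p) (auto simp: T_scale scale_right_distrib)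

lemma apply_poly_sum: "apply_poly (\<Sum>i\<in>I. p i) v = (\<Sum>i\<in>I. apply_poly (p i) v)"
  by (induction I rule: infinite_finite_induct) (auto simp: apply_poly_add)

lemma apply_poly_monom: "apply_poly (monom a k) v = a *s (T ^^ k) v"
  by (induction k) (auto simp: monom_Suc T_scale T_0 monom_0)

lemma apply_poly_linear_factor:
  "apply_poly ([:- c, 1:] * q) v = T (apply_poly q v) - c *s apply_poly q v"
proof -
  have "[:- c, 1:] * q = pCons 0 q + smult (- c) q" by simp
  then show ?thesis by (simp only: apply_poly_add apply_poly_smult apply_poly_pCons) simp
qed

lemma apply_poly_diff_arg: "apply_poly p (v - w) = apply_poly p v - apply_poly p w"
  by (induction p) (auto simp: T_diff scale_right_diff_distrib)

lemma apply_poly_eigen: "T w = c *s w \<Longrightarrow> apply_poly p (b *s w) = (poly p c * b) *s w"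
  by (induction p) (auto simp: T_scale algebra_simps simp flip: scale_left_distrib)

lemma apply_poly_closed: "v \<in> U \<Longrightarrow> apply_poly p v \<in> U"
  by (induction p)
    (auto intro!: subspace_add[OF subspace_U] subspace_scale[OF subspace_U] T_closed
      simp: subspace_0[OF subspace_U])

text \<open>
  For a root \<open>c\<close> of \<open>p = (X - c) q\<close>, the vector \<open>w = q(T) v\<close> is an eigenvector or zero, and a multiple
  of \<open>w\<close> can be split off from \<open>v\<close> to leave a vector annihilated by \<open>q\<close>: symmetry excludes
  \<open>q(c) = 0\<close>, which would make \<open>w\<close> orthogonal to itself.
\<close>

lemma in_span_eigenvectors_if_annihilated:
  assumes "p \<noteq> 0" "apply_poly p v = 0" "v \<in> U"
  shows "\<exists>A. finite A \<and> (\<forall>x\<in>A. \<exists>c. eigen c x) \<and> v \<in> span A"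
  using assms
proof (induction "degree p" arbitrary: p v)
  case 0
  then obtain a where "p = [:a:]" by (auto elim: degree_eq_zeroE)
  then have "v = 0" using 0 by (auto simp: T_0)
  then show ?case by (intro exI[of _ "{}"]) auto
next
  case (Suc n)
  have "\<not> constant (poly p)"
    using Suc.hyps(2) by (simp add: constant_degree)
  then obtain c where "poly p c = 0"
    using fundamental_theorem_of_algebra by blast
  then obtain q where q: "p = [:- c, 1:] * q"
    by (auto simp: poly_eq_0_iff_dvd dvd_def)
  have "q \<noteq> 0" using Suc.prems(1) q by auto
  then have "degree p = degree q + 1" unfolding q by (subst degree_mult_eq) auto
  then have deg: "n = degree q" using Suc.hyps(2) by simp
  define w where "w = apply_poly q v"
  have Tw: "T w = c *s w"
    using Suc.prems(2) unfolding q apply_poly_linear_factor w_def by simp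
  have wU: "w \<in> U" using Suc.prems(3) by (simp add: w_def apply_poly_closed)
  show ?case
  proof (cases "w = 0")
    case True
    then show ?thesis using Suc.hyps(1)[OF deg \<open>q \<noteq> 0\<close>] Suc.prems(3) by (simp add: w_def)
  next
    case False
    then have w: "eigen c w" using Tw wU by (simp add: eigen_def)
    have "poly q c \<noteq> 0"
    proof
      assume "poly q c = 0"
      then obtain r' where r': "q = [:- c, 1:] * r'"
        by (auto simp: poly_eq_0_iff_dvd dvd_def)
      define u where "u = apply_poly r' v"
      have uU: "u \<in> U" using Suc.prems(3) by (simp add: u_def apply_poly_closed)
      have wu: "w = T u - c *s u" unfolding w_def r' apply_poly_linear_factor u_def ..
      have "ip w w = ip (T u) w - ip (c *s u) w"
        unfolding wu[symmetric] by (subst wu)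
          (use uU wU in \<open>intro ip_diff T_closed subspace_scale[OF subspace_U]\<close>)
      also have "\<dots> = 0"
        using uU wU Tw eigen_value_real[OF w] by (simp add: T_symmetric ip_scale ip_scale_right)
      finally show False using ip_self_nonzero[OF wU False] by simp
    qed
    \<comment> \<open>Since \<open>w\<close> has eigenvalue \<open>c\<close>, applying
      \<open>q\<close> multiplies it by \<open>poly q c\<close>; this \<open>b\<close> makes the
      image of \<open>b *s w\<close> equal to \<open>w\<close>, the image of
      \<open>v\<close>.\<close>
    define b where "b = 1 / poly q c"
    have "apply_poly q (v - b *s w) = 0"
      using \<open>poly q c \<noteq> 0\<close> by (simp add: apply_poly_diff_arg apply_poly_eigen[OF Tw] b_def flip: w_def)
    moreover have "v - b *s w \<in> U"
      using Suc.prems(3) wU by (intro subspace_diff subspace_scale subspace_U)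
    ultimately obtain A where A: "finite A" "\<forall>x\<in>A. \<exists>c. eigen c x" "v - b *s w \<in> span A"
      using Suc.hyps(1)[OF deg \<open>q \<noteq> 0\<close>] by blast
    have "v - b *s w + b *s w \<in> span (insert w A)"
      using A(3) span_mono[of A "insert w A"] by (intro span_add span_scale[OF span_base]) auto
    then show ?thesis using A w by (intro exI[of _ "insert w A"]) auto
  qed
qed

text \<open>The iterates of \<open>v\<close> under \<open>T\<close> with exponents up to
  \<open>card t\<close> are one vector too many for the span of \<open>t\<close>. A linear relation
  between them is a nonzero polynomial annihilating \<open>v\<close>.\<close>

lemma in_span_eigenvectors:
  assumes "finite t" "t \<subseteq> U" "\<And>x. x \<in> t \<Longrightarrow> T x \<in> span t" "v \<in> span t"
  shows "\<exists>A. finite A \<and> (\<forall>x\<in>A. \<exists>c. eigen c x) \<and> v \<in> span A"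
proof -
  have T_span: "T x \<in> span t" if "x \<in> span t" for x
    using that
  proof (induction rule: span_induct_alt)
    case base
    then show ?case by (simp add: T_0 span_zero)
  next
    case (step c x y)
    then show ?case using assms(3) by (simp add: T_add T_scale span_add span_scale)
  qed
  have "(T ^^ k) v \<in> span t" for k
    by (induction k) (auto simp: assms(4) T_span)
  then obtain a where a: "\<exists>k\<le>card t. a k \<noteq> 0" "(\<Sum>k\<le>card t. a k *s (T ^^ k) v) = 0"
    using family_dependent[OF assms(1), of "\<lambda>k. (T ^^ k) v"] by auto
  define p where "p = (\<Sum>k\<le>card t. monom (a k) k)"
  have "coeff p k = a k" if "k \<le> card t" for k
    using that by (simp add: p_def coeff_sum)
  then have "p \<noteq> 0" using a(1) by auto
  moreover have "apply_poly p v = 0"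
    using a(2) by (simp add: p_def apply_poly_sum apply_poly_monom)
  moreover have "v \<in> U"
    using assms(2,4) span_minimal[OF _ subspace_U] by blast
  ultimately show ?thesis by (rule in_span_eigenvectors_if_annihilated)
qed

section \<open>Orthonormal systems of eigenvectors\<close>

definition orthonormal_eigenvectors :: "'v set \<Rightarrow> bool" where
  "orthonormal_eigenvectors B \<longleftrightarrow> (\<forall>b\<in>B. \<exists>c. eigen c b) \<and>
     (\<forall>b\<in>B. \<forall>b'\<in>B. ip b b' = (if b = b' then 1 else 0))"

text \<open>
  Eigenvectors for different eigenvalues are orthogonal, so each Gram-Schmidt step only subtracts
  eigenvectors for the same eigenvalue.
\<close>

lemma gram_schmidt_step:
  assumes B: "finite B" "orthonormal_eigenvectors B" and x: "eigen c x"
  shows "\<exists>B'. finite B' \<and> orthonormal_eigenvectors B' \<and> B \<subseteq> B' \<and> x \<in> span B'"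
proof -
  define y where "y = (\<Sum>b\<in>B. ip x b *s b)"
  define w where "w = x - y"
  have BU: "b \<in> U" if "b \<in> B" for b
    using B that by (auto simp: orthonormal_eigenvectors_def eigen_def)
  have xU: "x \<in> U" and Tx: "T x = c *s x" using x by (auto simp: eigen_def)
  have "T y = (\<Sum>b\<in>B. ip x b *s T b)" by (simp add: y_def T_sum T_scale)
  also have "\<dots> = (\<Sum>b\<in>B. c *s ip x b *s b)"
  proof (rule sum.cong)
    fix b assume "b \<in> B"
    then obtain c' where c': "eigen c' b" using B by (auto simp: orthonormal_eigenvectors_def)
    show "ip x b *s T b = c *s ip x b *s b"
      using c' eigen_orthogonal[OF x c'] by (cases "c = c'") (auto simp: eigen_def mult.commute)
  qed simp
  finally have "T y = c *s y" by (simp add: y_def scale_sum_right)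
  then have Tw: "T w = c *s w" by (simp add: w_def T_diff Tx scale_right_diff_distrib)
  have yU: "y \<in> U"
    unfolding y_def using BU by (intro subspace_sum subspace_scale subspace_U)
  then have wU: "w \<in> U" using xU by (simp add: w_def subspace_diff[OF subspace_U])
  have wB: "ip w b = 0" if "b \<in> B" for b
  proof -
    have "ip y b = (\<Sum>b'\<in>B. ip (ip x b' *s b') b)"
      unfolding y_def using BU that by (intro ip_sum subspace_scale subspace_U)
    also have "\<dots> = (\<Sum>b'\<in>B. if b' = b then ip x b else 0)"
      using that BU B by (intro sum.cong) (auto simp: ip_scale orthonormal_eigenvectors_def)
    finally show ?thesis using that B BU xU yU by (simp add: w_def ip_diff)
  qed
  have ySpan: "y \<in> span B" unfolding y_def by (intro span_sum span_scale span_base)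
  show ?thesis
  proof (cases "w = 0")
    case True
    then have "x \<in> span B" using ySpan by (simp add: w_def)
    then show ?thesis using B by blast
  next
    case False
    then obtain r where r: "r > 0" "ip w w = complex_of_real r" using ip_pos wU by blast
    define e where "e = complex_of_real (1 / sqrt r) *s w"
    have eU: "e \<in> U" using wU by (simp add: e_def subspace_scale[OF subspace_U])
    have "eigen c e"
      using False r Tw eU by (auto simp: eigen_def e_def T_scale mult.commute)
    moreover have "ip e e = 1"
    proof -
      have "ip e e = complex_of_real (1 / sqrt r) * (complex_of_real (1 / sqrt r) * complex_of_real r)"
        using wU eU r(2)
        by (simp add: e_def ip_scale ip_scale_right subspace_scale[OF subspace_U] del: of_real_divide)
      also have "\<dots> = complex_of_real (1 / sqrt r * (1 / sqrt r) * r)"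
        by (simp only: of_real_mult mult.assoc)
      also have "1 / sqrt r * (1 / sqrt r) * r = 1" using r(1) by (simp add: field_simps)
      finally show ?thesis by simp
    qed
    moreover have eB: "ip e b = 0" if "b \<in> B" for b
      using that wU BU wB by (simp add: e_def ip_scale)
    moreover have "ip b e = 0" if "b \<in> B" for b
      using eB[OF that] ip_commute[OF eU BU[OF that]] by simp
    moreover have "e \<notin> B" using eB[of e] \<open>ip e e = 1\<close> by auto
    ultimately have "orthonormal_eigenvectors (insert e B)"
      using B(2) unfolding orthonormal_eigenvectors_def by auto
    moreover have "x \<in> span (insert e B)"
    proof -
      have "complex_of_real (sqrt r) *s e = complex_of_real (sqrt r * (1 / sqrt r)) *s w"
        by (simp add: e_def)
      also have "sqrt r * (1 / sqrt r) = 1" using r(1) by simp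
      finally have "w = complex_of_real (sqrt r) *s e" by simp
      then have "w \<in> span (insert e B)" by (simp add: span_scale span_base)
      then have "w + y \<in> span (insert e B)"
        using ySpan span_mono[of B "insert e B"] by (intro span_add) auto
      then show ?thesis by (simp add: w_def)
    qed
    ultimately show ?thesis using B(1) by (intro exI[of _ "insert e B"]) auto
  qed
qed

text \<open>Countability allows the vectors of \<open>A\<close> to be absorbed one at a time, with a
  finite system at each stage. No closure is taken: every vector of \<open>A\<close> lies in the
  span of some finite stage.\<close>

theorem orthonormal_eigenvectors_exist:
  assumes "countable A" "\<And>x. x \<in> A \<Longrightarrow> \<exists>c. eigen c x"
  shows "\<exists>B. orthonormal_eigenvectors B \<and> A \<subseteq> span B"
proof (cases "A = {}")
  case True
  then show ?thesis by (intro exI[of _ "{}"]) (auto simp: orthonormal_eigenvectors_def)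
next
  case False
  define f where "f = from_nat_into A"
  have f: "range f = A" using assms(1) False by (simp add: f_def range_from_nat_into)
  \<comment> \<open>The stages increase, so any two members of the union belong to a common stage
    and orthonormality passes to the limit.\<close>
  have "\<exists>B. \<forall>n. (finite (B n) \<and> orthonormal_eigenvectors (B n)) \<and>
      (B n \<subseteq> B (Suc n) \<and> f n \<in> span (B (Suc n)))"
  proof (rule dependent_nat_choice)
    show "\<exists>B. finite B \<and> orthonormal_eigenvectors B"
      by (intro exI[of _ "{}"]) (auto simp: orthonormal_eigenvectors_def)
    fix B n assume B: "finite B \<and> orthonormal_eigenvectors B"
    obtain c where "eigen c (f n)" using assms(2) f by blast
    then show "\<exists>B'. (finite B' \<and> orthonormal_eigenvectors B') \<and> (B \<subseteq> B' \<and> f n \<in> span B')"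
      using gram_schmidt_step[of B c "f n"] B by blast
  qed
  then obtain B where B: "\<And>n. orthonormal_eigenvectors (B n)" "\<And>n. B n \<subseteq> B (Suc n)"
    "\<And>n. f n \<in> span (B (Suc n))" by blast
  have mono: "B m \<subseteq> B n" if "m \<le> n" for m n
    using B(2) that by (rule lift_Suc_mono_le)
  have "orthonormal_eigenvectors (\<Union>n. B n)"
    unfolding orthonormal_eigenvectors_def
  proof (intro conjI ballI)
    show "\<exists>c. eigen c b" if "b \<in> (\<Union>n. B n)" for b
      using that B(1) by (auto simp: orthonormal_eigenvectors_def)
    fix b b' assume "b \<in> (\<Union>n. B n)" "b' \<in> (\<Union>n. B n)"
    then obtain m n where "b \<in> B m" "b' \<in> B n" by blast
    then have "b \<in> B (max m n)" "b' \<in> B (max m n)"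
      using mono[of m "max m n"] mono[of n "max m n"] by auto
    then show "ip b b' = (if b = b' then 1 else 0)"
      using B(1)[of "max m n"] unfolding orthonormal_eigenvectors_def by blast
  qed
  moreover have "A \<subseteq> span (\<Union>n. B n)"
  proof
    fix x assume "x \<in> A"
    then obtain n where "x = f n" using f by blast
    then show "x \<in> span (\<Union>n. B n)" using B(3) span_mono[of "B (Suc n)" "\<Union>n. B n"] by blast
  qed
  ultimately show ?thesis by blast
qed

end

section \<open>Square-summable functions\<close>

interpretation fun_space: vector_space "\<lambda>(c::complex) (F::'x \<Rightarrow> complex) x. c * F x"
  by unfold_locales (auto simp: fun_eq_iff algebra_simps)

lemma sum_fun_apply: "(\<Sum>i\<in>I. F i) x = (\<Sum>i\<in>I. F i x)"
  for F :: "'i \<Rightarrow> 'x \<Rightarrow> 'y::comm_monoid_add"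
  by (induction I rule: infinite_finite_induct) auto

definition finsupp :: "'x set \<Rightarrow> ('x \<Rightarrow> complex) set" where
  "finsupp X = {F. finite {x. F x \<noteq> 0} \<and> {x. F x \<noteq> 0} \<subseteq> X}"

lemma finsuppI: "finite Z \<Longrightarrow> Z \<subseteq> X \<Longrightarrow> (\<And>x. x \<notin> Z \<Longrightarrow> F x = 0) \<Longrightarrow> F \<in> finsupp X"
  unfolding finsupp_def by (auto intro: finite_subset[of _ Z])

lemma finsuppE:
  assumes "F \<in> finsupp X" "G \<in> finsupp X"
  obtains Z where "finite Z" "Z \<subseteq> X" "\<And>x. x \<notin> Z \<Longrightarrow> F x = 0" "\<And>x. x \<notin> Z \<Longrightarrow> G x = 0"
proof (rule that)
  show "finite ({x. F x \<noteq> 0} \<union> {x. G x \<noteq> 0})" "{x. F x \<noteq> 0} \<union> {x. G x \<noteq> 0} \<subseteq> X"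
    using assms by (auto simp: finsupp_def)
qed auto

lemma finsupp_subspace: "fun_space.subspace (finsupp X)"
proof (rule fun_space.subspaceI)
  fix F G :: "'a \<Rightarrow> complex" assume "F \<in> finsupp X" "G \<in> finsupp X"
  then obtain Z where "finite Z" "Z \<subseteq> X" "\<And>x. x \<notin> Z \<Longrightarrow> F x = 0" "\<And>x. x \<notin> Z \<Longrightarrow> G x = 0"
    using finsuppE by blast
  then show "F + G \<in> finsupp X" by (intro finsuppI[of Z]) auto
qed (auto simp: finsupp_def elim: finite_subset[rotated])

lemma ell2_inner_finite:
  assumes "finite Z" "Z \<subseteq> X" "\<And>x. x \<notin> Z \<Longrightarrow> F x = 0"
  shows "ell2_inner X F G = (\<Sum>x\<in>Z. F x * cnj (G x))"
proof -
  have "ell2_inner X F G = (\<Sum>\<^sub>\<infinity>x\<in>Z. F x * cnj (G x))"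
    unfolding ell2_inner_def by (rule infsum_cong_neutral) (use assms in auto)
  then show ?thesis using assms(1) by simp
qed

text \<open>The squared norm is the quantity that will be a percolation probability; square roots
  enter only through \<open>ell2_norm_less_iff\<close>.\<close>

definition norm2 :: "'x set \<Rightarrow> ('x \<Rightarrow> complex) \<Rightarrow> real" where
  "norm2 X F = (\<Sum>\<^sub>\<infinity>x\<in>X. (cmod (F x))\<^sup>2)"

lemma ell2_norm_less_iff: "0 < \<epsilon> \<Longrightarrow> ell2_norm X F < \<epsilon> \<longleftrightarrow> norm2 X F < \<epsilon>\<^sup>2"
  unfolding ell2_norm_def norm2_def
  by (metis abs_of_pos less_eq_real_def real_sqrt_abs real_sqrt_less_iff)

lemma norm2_scale: "norm2 X (\<lambda>x. c * F x) = (cmod c)\<^sup>2 * norm2 X F"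
  unfolding norm2_def by (simp add: norm_mult power_mult_distrib infsum_cmult_right')

lemma finsupp_ell2: "F \<in> finsupp X \<Longrightarrow> F \<in> ell2 X"
proof -
  assume F: "F \<in> finsupp X"
  have "(\<lambda>x. (cmod (F x))\<^sup>2) summable_on {x. F x \<noteq> 0}"
    using F by (intro summable_on_finite) (auto simp: finsupp_def)
  then have "(\<lambda>x. (cmod (F x))\<^sup>2) summable_on X"
    by (rule summable_on_cong_neutral[THEN iffD1, rotated -1]) (use F in \<open>auto simp: finsupp_def\<close>)
  then show ?thesis using F by (auto simp: ell2_def finsupp_def)
qed

lemma norm2_finite:
  assumes "finite Z" "Z \<subseteq> X" "\<And>x. x \<notin> Z \<Longrightarrow> F x = 0"
  shows "norm2 X F = (\<Sum>x\<in>Z. (cmod (F x))\<^sup>2)"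
proof -
  have "norm2 X F = (\<Sum>\<^sub>\<infinity>x\<in>Z. (cmod (F x))\<^sup>2)"
    unfolding norm2_def by (rule infsum_cong_neutral) (use assms in auto)
  then show ?thesis using assms(1) by simp
qed

text \<open>The pointwise bound |a + b|^2 \<le> 2 |a|^2 + 2 |b|^2 serves as triangle inequality for
  squared norms. Its factor 2 is why errors below are split into quarters of \<epsilon>.\<close>

lemma
  assumes "F \<in> ell2 X" "G \<in> ell2 X"
  shows ell2_add: "(\<lambda>x. F x + G x) \<in> ell2 X"
    and norm2_add: "norm2 X (\<lambda>x. F x + G x) \<le> 2 * norm2 X F + 2 * norm2 X G"
proof -
  have le: "(cmod (F x + G x))\<^sup>2 \<le> 2 * (cmod (F x))\<^sup>2 + 2 * (cmod (G x))\<^sup>2" for x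
  proof -
    have "(cmod (F x + G x))\<^sup>2 \<le> (cmod (F x) + cmod (G x))\<^sup>2"
      by (intro power_mono norm_triangle_ineq) auto
    also have "\<dots> \<le> 2 * (cmod (F x))\<^sup>2 + 2 * (cmod (G x))\<^sup>2"
      using sum_squares_bound[of "cmod (F x)" "cmod (G x)"] by (simp add: power2_sum)
    finally show ?thesis .
  qed
  have sF: "(\<lambda>x. 2 * (cmod (F x))\<^sup>2) summable_on X" and sG: "(\<lambda>x. 2 * (cmod (G x))\<^sup>2) summable_on X"
    using assms by (auto simp: ell2_def intro!: summable_on_cmult_right)
  note s = summable_on_add[OF sF sG]
  have sum: "(\<lambda>x. (cmod (F x + G x))\<^sup>2) summable_on X"
    by (rule summable_on_comparison_test[OF s]) (use le in auto)
  then show "(\<lambda>x. F x + G x) \<in> ell2 X" using assms by (auto simp: ell2_def)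
  have "norm2 X (\<lambda>x. F x + G x) \<le> (\<Sum>\<^sub>\<infinity>x\<in>X. 2 * (cmod (F x))\<^sup>2 + 2 * (cmod (G x))\<^sup>2)"
    unfolding norm2_def by (rule infsum_mono[OF sum s]) (rule le)
  also have "\<dots> = 2 * norm2 X F + 2 * norm2 X G"
    unfolding norm2_def infsum_add[OF sF sG] by (simp add: infsum_cmult_right')
  finally show "norm2 X (\<lambda>x. F x + G x) \<le> 2 * norm2 X F + 2 * norm2 X G" .
qed

lemma ell2_scale: "F \<in> ell2 X \<Longrightarrow> (\<lambda>x. c * F x) \<in> ell2 X"
  by (auto simp: ell2_def norm_mult power_mult_distrib intro!: summable_on_cmult_right)

lemma ell2_diff:
  assumes "F \<in> ell2 X" "G \<in> ell2 X"
  shows "(\<lambda>x. F x - G x) \<in> ell2 X"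
  using ell2_add[OF assms(1) ell2_scale[OF assms(2), of "- 1"]] by simp

lemma ell2_truncate:
  assumes "F \<in> ell2 X" "0 < \<epsilon>"
  shows "\<exists>Z. finite Z \<and> Z \<subseteq> X \<and> norm2 X (\<lambda>x. F x - (if x \<in> Z then F x else 0)) < \<epsilon>"
proof -
  let ?f = "\<lambda>x. (cmod (F x))\<^sup>2"
  have s: "?f summable_on X" using assms by (simp add: ell2_def)
  then obtain Z where Z: "finite Z" "Z \<subseteq> X" "dist (sum ?f Z) (infsum ?f X) \<le> \<epsilon> / 2"
    using infsum_finite_approximation[OF s, of "\<epsilon> / 2"] assms(2) by auto
  have "norm2 X (\<lambda>x. F x - (if x \<in> Z then F x else 0)) = infsum ?f (X - Z)"
    unfolding norm2_def by (rule infsum_cong_neutral) auto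
  also have "\<dots> = infsum ?f X - infsum ?f Z"
    using s Z by (intro infsum_Diff) (auto intro: summable_on_finite)
  also have "\<dots> \<le> \<epsilon> / 2"
    using Z(3) infsum_finite[OF Z(1), of ?f] unfolding dist_real_def by linarith
  also have "\<dots> < \<epsilon>" using assms(2) by simp
  finally show ?thesis using Z by blast
qed

section \<open>Approximation in the norm by vectors of a subspace\<close>

definition approximable :: "'x set \<Rightarrow> ('x \<Rightarrow> complex) set \<Rightarrow> ('x \<Rightarrow> complex) \<Rightarrow> bool" where
  "approximable X W F \<longleftrightarrow> (\<forall>\<epsilon>>0. \<exists>u\<in>W. norm2 X (\<lambda>x. F x - u x) < \<epsilon>)"

lemma approximable_add:
  assumes W: "fun_space.subspace W" "W \<subseteq> ell2 X" and FG: "F \<in> ell2 X" "G \<in> ell2 X"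
    and ap: "approximable X W F" "approximable X W G"
  shows "approximable X W (\<lambda>x. F x + G x)"
  unfolding approximable_def
proof (intro allI impI)
  fix \<epsilon> :: real assume "0 < \<epsilon>"
  then obtain u v where u: "u \<in> W" "norm2 X (\<lambda>x. F x - u x) < \<epsilon> / 4"
    and v: "v \<in> W" "norm2 X (\<lambda>x. G x - v x) < \<epsilon> / 4"
    using ap unfolding approximable_def by (metis divide_pos_pos zero_less_numeral)
  have "norm2 X (\<lambda>x. (F x - u x) + (G x - v x)) \<le>
      2 * norm2 X (\<lambda>x. F x - u x) + 2 * norm2 X (\<lambda>x. G x - v x)"
    using u v W FG by (intro norm2_add ell2_diff) auto
  then have "norm2 X (\<lambda>x. F x + G x - (u + v) x) < \<epsilon>"
    using u v by (simp add: add_diff_add)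
  then show "\<exists>u\<in>W. norm2 X (\<lambda>x. F x + G x - u x) < \<epsilon>"
    using fun_space.subspace_add[OF W(1) u(1) v(1)] by blast
qed

lemma approximable_scale:
  assumes W: "fun_space.subspace W" and ap: "approximable X W F"
  shows "approximable X W (\<lambda>x. c * F x)"
proof (cases "c = 0")
  case True
  have "norm2 X (\<lambda>x. c * F x - 0 x) = 0" using True by (simp add: norm2_def)
  then show ?thesis
    using fun_space.subspace_0[OF W] unfolding approximable_def by force
next
  case False
  show ?thesis
    unfolding approximable_def
  proof (intro allI impI)
    fix \<epsilon> :: real assume "0 < \<epsilon>"
    then obtain u where u: "u \<in> W" "norm2 X (\<lambda>x. F x - u x) < \<epsilon> / (cmod c)\<^sup>2"
      using ap False unfolding approximable_def by (metis divide_pos_pos zero_less_norm_iff zero_less_power)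
    have "norm2 X (\<lambda>x. c * F x - c * u x) < \<epsilon>"
      using u(2) False norm2_scale[of X c "\<lambda>x. F x - u x"]
      by (simp add: right_diff_distrib pos_less_divide_eq mult.commute)
    then show "\<exists>u\<in>W. norm2 X (\<lambda>x. c * F x - u x) < \<epsilon>"
      using fun_space.subspace_scale[OF W u(1), of c] by (intro bexI[of _ "\<lambda>x. c * u x"])
  qed
qed

text \<open>Up to a small tail, a square-summable function is a finite combination of point
  masses.\<close>

lemma approximable_if_point_masses:
  assumes W: "fun_space.subspace W" "W \<subseteq> ell2 X"
    and ap: "\<And>z. z \<in> X \<Longrightarrow> approximable X W (\<lambda>x. of_bool (x = z))"
    and F: "F \<in> ell2 X"
  shows "approximable X W F"
proof -
  have trunc: "approximable X W (\<lambda>x. if x \<in> Z then F x else 0)" if "finite Z" "Z \<subseteq> X" for Z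
    using that
  proof (induction Z)
    case empty
    have "norm2 X (\<lambda>x. 0 - 0 x) = 0" by (simp add: norm2_def)
    then show ?case
      using fun_space.subspace_0[OF W(1)] unfolding approximable_def by force
  next
    case (insert z Z)
    have "approximable X W (\<lambda>x. (if x \<in> Z then F x else 0) + F z * of_bool (x = z))"
    proof (rule approximable_add[OF W])
      show "(\<lambda>x. if x \<in> Z then F x else 0) \<in> ell2 X"
        using insert by (intro finsupp_ell2 finsuppI[of Z]) auto
      show "(\<lambda>x. F z * of_bool (x = z)) \<in> ell2 X"
        using insert by (intro finsupp_ell2 finsuppI[of "{z}"]) auto
      show "approximable X W (\<lambda>x. F z * of_bool (x = z))"
        using insert by (intro approximable_scale W ap) auto
    qed (use insert in auto)
    moreover have "(\<lambda>x. (if x \<in> Z then F x else 0) + F z * of_bool (x = z)) =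
        (\<lambda>x. if x \<in> insert z Z then F x else 0)"
      using insert by (auto simp: fun_eq_iff)
    ultimately show ?case by simp
  qed
  show ?thesis
    unfolding approximable_def
  proof (intro allI impI)
    fix \<epsilon> :: real assume "0 < \<epsilon>"
    then obtain Z where Z: "finite Z" "Z \<subseteq> X"
      "norm2 X (\<lambda>x. F x - (if x \<in> Z then F x else 0)) < \<epsilon> / 4"
      using ell2_truncate[OF F, of "\<epsilon> / 4"] by auto
    then obtain u where u: "u \<in> W" "norm2 X (\<lambda>x. (if x \<in> Z then F x else 0) - u x) < \<epsilon> / 4"
      using trunc[of Z] \<open>0 < \<epsilon>\<close> unfolding approximable_def by (metis divide_pos_pos zero_less_numeral)
    have Zl: "(\<lambda>x. if x \<in> Z then F x else 0) \<in> ell2 X"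
      using Z by (intro finsupp_ell2 finsuppI[of Z]) auto
    have "norm2 X (\<lambda>x. F x - u x) =
      norm2 X (\<lambda>x. (F x - (if x \<in> Z then F x else 0)) + ((if x \<in> Z then F x else 0) - u x))"
      by simp
    also have "\<dots> \<le> 2 * norm2 X (\<lambda>x. F x - (if x \<in> Z then F x else 0)) +
      2 * norm2 X (\<lambda>x. (if x \<in> Z then F x else 0) - u x)"
      using F Zl u W by (intro norm2_add ell2_diff) auto
    also have "\<dots> < \<epsilon>" using Z u by simp
    finally show "\<exists>u\<in>W. norm2 X (\<lambda>x. F x - u x) < \<epsilon>" using u(1) by blast
  qed
qed

text \<open>Each member of \<open>E\<close> lies in a finite-dimensional invariant space and is
  therefore a finite combination of eigenvectors. Collecting these over the countable set
  \<open>E\<close> and orthonormalising them gives a system whose span contains \<open>E\<close>, so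
  density can be tested on \<open>E\<close> and on point masses.\<close>

theorem pure_point_spectrum_criterion:
  assumes T_add: "\<And>F G. T (\<lambda>x. F x + G x) = (\<lambda>x. T F x + T G x)"
    and T_scale: "\<And>c F. T (\<lambda>x. c * F x) = (\<lambda>x. c * T F x)"
    and T_closed: "\<And>F. F \<in> finsupp X \<Longrightarrow> T F \<in> finsupp X"
    and T_symmetric: "\<And>F G. F \<in> finsupp X \<Longrightarrow> G \<in> finsupp X \<Longrightarrow>
      ell2_inner X (T F) G = ell2_inner X F (T G)"
    and E: "countable E"
    and inv: "\<And>v. v \<in> E \<Longrightarrow> \<exists>t. finite t \<and> t \<subseteq> finsupp X \<and> v \<in> fun_space.span t \<and>
      (\<forall>x\<in>t. T x \<in> fun_space.span t)"
    and dense: "\<And>z. z \<in> X \<Longrightarrow> approximable X (fun_space.span E) (\<lambda>x. of_bool (x = z))"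
  shows "pure_point_spectrum X T"
proof -
  interpret S: symmetric_operator "\<lambda>(c::complex) (F::'a \<Rightarrow> complex) x. c * F x" "ell2_inner X" T "finsupp X"
  proof unfold_locales
    show "fun_space.subspace (finsupp X)" by (rule finsupp_subspace)
    fix F G K :: "'a \<Rightarrow> complex" and c
    show "T (F + G) = T F + T G" "T (\<lambda>x. c * F x) = (\<lambda>x. c * T F x)"
      using T_add[of F G] T_scale by (simp_all add: plus_fun_def)
    assume F: "F \<in> finsupp X"
    show "T F \<in> finsupp X" by (rule T_closed[OF F])
    obtain Z where Z: "finite Z" "Z \<subseteq> X" "\<And>x. x \<notin> Z \<Longrightarrow> F x = 0"
      using finsuppE[OF F F] by metis
    show "ell2_inner X (\<lambda>x. c * F x) G = c * ell2_inner X F G"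
      using Z by (simp add: ell2_inner_finite[of Z] sum_distrib_left mult.assoc)
    show "\<exists>r>0. ell2_inner X F F = complex_of_real r" if nz: "F \<noteq> 0"
    proof (intro exI conjI)
      show "ell2_inner X F F = complex_of_real (\<Sum>x\<in>Z. (cmod (F x))\<^sup>2)"
        using Z by (simp add: ell2_inner_finite[of Z] complex_norm_square del: of_real_power)
      obtain x where "F x \<noteq> 0" using nz by (auto simp: fun_eq_iff)
      then show "0 < (\<Sum>x\<in>Z. (cmod (F x))\<^sup>2)"
        using Z by (intro sum_pos2[of _ x]) auto
    qed
    assume G: "G \<in> finsupp X"
    show "ell2_inner X (T F) G = ell2_inner X F (T G)" by (rule T_symmetric[OF F G])
    obtain Z where Z: "finite Z" "Z \<subseteq> X" "\<And>x. x \<notin> Z \<Longrightarrow> F x = 0" "\<And>x. x \<notin> Z \<Longrightarrow> G x = 0"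
      using finsuppE[OF F G] by metis
    show "ell2_inner X G F = cnj (ell2_inner X F G)"
      using Z by (simp add: ell2_inner_finite[of Z] mult.commute)
    show "ell2_inner X (F + G) K = ell2_inner X F K + ell2_inner X G K"
      using Z by (simp add: ell2_inner_finite[of Z] algebra_simps sum.distrib)
  qed
  have "\<forall>v\<in>E. \<exists>A. finite A \<and> (\<forall>x\<in>A. \<exists>c. S.eigen c x) \<and> v \<in> fun_space.span A"
    using inv S.in_span_eigenvectors by metis
  then obtain A where A: "\<And>v. v \<in> E \<Longrightarrow> finite (A v)" "\<And>v x. v \<in> E \<Longrightarrow> x \<in> A v \<Longrightarrow> \<exists>c. S.eigen c x"
    "\<And>v. v \<in> E \<Longrightarrow> v \<in> fun_space.span (A v)" by metis
  have "countable (\<Union>v\<in>E. A v)" using E A(1) by (intro countable_UN) (auto intro: countable_finite)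
  then obtain B where B: "S.orthonormal_eigenvectors B" "(\<Union>v\<in>E. A v) \<subseteq> fun_space.span B"
    using S.orthonormal_eigenvectors_exist[of "\<Union>v\<in>E. A v"] A(2) by auto
  have "E \<subseteq> fun_space.span B"
  proof
    fix v assume v: "v \<in> E"
    then have "A v \<subseteq> fun_space.span B" using B(2) by blast
    then have "fun_space.span (A v) \<subseteq> fun_space.span B"
      by (rule fun_space.span_minimal) (rule fun_space.subspace_span)
    then show "v \<in> fun_space.span B" using A(3)[OF v] by blast
  qed
  then have EB: "fun_space.span E \<subseteq> fun_space.span B"
    by (rule fun_space.span_minimal) (rule fun_space.subspace_span)
  have Bf: "B \<subseteq> finsupp X"
    using B(1) by (auto simp: S.orthonormal_eigenvectors_def S.eigen_def)
  then have spB: "fun_space.span B \<subseteq> ell2 X"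
    using fun_space.span_minimal[OF Bf finsupp_subspace] finsupp_ell2 by blast
  have "complete_system X B"
    unfolding complete_system_def
  proof (intro ballI allI impI)
    fix F and \<epsilon> :: real assume F: "F \<in> ell2 X" and "0 < \<epsilon>"
    have "approximable X (fun_space.span B) F"
    proof (rule approximable_if_point_masses[OF fun_space.subspace_span spB _ F])
      show "approximable X (fun_space.span B) (\<lambda>x. of_bool (x = z))" if "z \<in> X" for z
        using dense[OF that] EB unfolding approximable_def by blast
    qed
    then obtain u where u: "u \<in> fun_space.span B" "norm2 X (\<lambda>x. F x - u x) < \<epsilon>\<^sup>2"
      using \<open>0 < \<epsilon>\<close> unfolding approximable_def by (metis zero_less_power)
    then obtain t c where t: "finite t" "t \<subseteq> B" "u = (\<Sum>b\<in>t. (\<lambda>x. c b * b x))"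
      by (auto simp: fun_space.span_explicit)
    have "u x = (\<Sum>b\<in>t. c b * b x)" for x
      unfolding t(3) by (rule sum_fun_apply)
    then have "ell2_norm X (\<lambda>x. F x - (\<Sum>b\<in>t. c b * b x)) < \<epsilon>"
      using u(2) \<open>0 < \<epsilon>\<close> by (simp add: ell2_norm_less_iff)
    then show "\<exists>A c. finite A \<and> A \<subseteq> B \<and> ell2_norm X (\<lambda>x. F x - (\<Sum>b\<in>A. c b * b x)) < \<epsilon>"
      using t by blast
  qed
  moreover have "orthonormal_system X B"
    using B(1) Bf finsupp_ell2 by (auto simp: orthonormal_system_def S.orthonormal_eigenvectors_def)
  moreover have "\<forall>b\<in>B. eigenvector X T b"
    using B(1) finsupp_ell2
    by (auto simp: S.orthonormal_eigenvectors_def S.eigen_def eigenvector_def zero_fun_def)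
  ultimately show ?thesis unfolding pure_point_spectrum_def by blast
qed

section \<open>Transition operators on groups\<close>

text \<open>Substituting \<open>y = inv z \<otimes> x\<close> turns the convolution into an integral
  kernel between two points, the form in which symmetry and the lamp averages become
  visible.\<close>

lemma (in group) transition_operator_kernel:
  assumes "x \<in> carrier G"
  shows "transition_operator G p F x =
    (\<Sum>\<^sub>\<infinity>z\<in>carrier G. F z * complex_of_real (pmf p (inv z \<otimes> x)))"
proof -
  have bij: "bij_betw (\<lambda>z. inv z \<otimes> x) (carrier G) (carrier G)"
    by (rule bij_betw_byWitness[where f' = "\<lambda>y. x \<otimes> inv y"])
      (use assms in \<open>auto simp: inv_mult_group m_assoc\<close>, simp flip: m_assoc)
  have "x \<otimes> inv (inv z \<otimes> x) = z" if "z \<in> carrier G" for z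
    using that assms by (simp add: inv_mult_group flip: m_assoc)
  then have "(\<Sum>\<^sub>\<infinity>z\<in>carrier G. F z * complex_of_real (pmf p (inv z \<otimes> x))) =
    (\<Sum>\<^sub>\<infinity>z\<in>carrier G. F (x \<otimes> inv (inv z \<otimes> x)) * complex_of_real (pmf p (inv z \<otimes> x)))"
    by (intro infsum_cong) simp
  also have "\<dots> = transition_operator G p F x"
    using assms infsum_reindex_bij_betw[OF bij, of "\<lambda>y. F (x \<otimes> inv y) * complex_of_real (pmf p y)"]
    by (simp add: transition_operator_def)
  finally show ?thesis ..
qed

lemma transition_operator_finite:
  assumes "finite (set_pmf p)"
  shows "transition_operator L p F x = (if x \<in> carrier L
    then \<Sum>y\<in>set_pmf p \<inter> carrier L. F (x \<otimes>\<^bsub>L\<^esub> inv\<^bsub>L\<^esub> y) * complex_of_real (pmf p y) else 0)"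
proof -
  have "(\<Sum>\<^sub>\<infinity>y\<in>carrier L. F (x \<otimes>\<^bsub>L\<^esub> inv\<^bsub>L\<^esub> y) * complex_of_real (pmf p y)) =
    (\<Sum>\<^sub>\<infinity>y\<in>set_pmf p \<inter> carrier L. F (x \<otimes>\<^bsub>L\<^esub> inv\<^bsub>L\<^esub> y) * complex_of_real (pmf p y))"
    by (rule infsum_cong_neutral) (auto simp: set_pmf_iff)
  then show ?thesis using assms by (simp add: transition_operator_def)
qed

lemma (in group) transition_operator_finsupp:
  assumes "finite (set_pmf p)" "F \<in> finsupp (carrier G)"
  shows "transition_operator G p F \<in> finsupp (carrier G)"
proof -
  obtain Z where Z: "finite Z" "Z \<subseteq> carrier G" "\<And>x. x \<notin> Z \<Longrightarrow> F x = 0"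
    using finsuppE[OF assms(2) assms(2)] by metis
  let ?Y = "(\<lambda>(z, y). z \<otimes> y) ` (Z \<times> (set_pmf p \<inter> carrier G))"
  show ?thesis
  proof (rule finsuppI[of ?Y])
    fix x assume x: "x \<notin> ?Y"
    have "F (x \<otimes> inv y) = 0" if "x \<in> carrier G" "y \<in> set_pmf p \<inter> carrier G" for y
    proof (rule Z(3), rule notI)
      assume "x \<otimes> inv y \<in> Z"
      moreover have "x = (x \<otimes> inv y) \<otimes> y" using that by (simp add: m_assoc)
      ultimately have "x \<in> ?Y" using that by (intro image_eqI[of _ _ "(x \<otimes> inv y, y)"]) auto
      then show False using x by blast
    qed
    then show "transition_operator G p F x = 0"
      by (simp add: transition_operator_finite[OF assms(1)])
  qed (use Z assms in auto)
qed

lemma (in group) transition_operator_symmetric: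
  assumes p: "finite (set_pmf p)" "symmetric_pmf G p"
    and F: "F \<in> finsupp (carrier G)" and F': "F' \<in> finsupp (carrier G)"
  shows "ell2_inner (carrier G) (transition_operator G p F) F' =
    ell2_inner (carrier G) F (transition_operator G p F')"
proof -
  let ?T = "transition_operator G p"
  obtain Y where Y: "finite Y" "Y \<subseteq> carrier G" "\<And>x. x \<notin> Y \<Longrightarrow> F x = 0" "\<And>x. x \<notin> Y \<Longrightarrow> F' x = 0"
    using finsuppE[OF F F'] by metis
  obtain W where W: "finite W" "W \<subseteq> carrier G" "\<And>x. x \<notin> W \<Longrightarrow> ?T F x = 0"
    using finsuppE[OF transition_operator_finsupp[OF p(1) F] transition_operator_finsupp[OF p(1) F]]
    by metis
  \<comment> \<open>\<open>Y\<close> carries both functions and \<open>W\<close> carries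
    \<open>?T F\<close>; on their union both inner products become double sums over the same finite
    square.\<close>
  let ?Z = "Y \<union> W"
  have T: "?T K x = (\<Sum>z\<in>?Z. K z * complex_of_real (pmf p (inv z \<otimes> x)))"
    if "\<And>x. x \<notin> Y \<Longrightarrow> K x = 0" "x \<in> carrier G" for K x
  proof -
    have "?T K x = (\<Sum>\<^sub>\<infinity>z\<in>?Z. K z * complex_of_real (pmf p (inv z \<otimes> x)))"
      unfolding transition_operator_kernel[OF that(2)]
      by (rule infsum_cong_neutral) (use that Y W in auto)
    then show ?thesis using Y W by simp
  qed
  have sym: "pmf p (inv z \<otimes> x) = pmf p (inv x \<otimes> z)" if "z \<in> ?Z" "x \<in> ?Z" for x z
  proof -
    have xz: "x \<in> carrier G" "z \<in> carrier G" using that Y W by auto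
    then have "inv (inv x \<otimes> z) = inv z \<otimes> x" by (simp add: inv_mult_group)
    then show ?thesis using p(2) xz unfolding symmetric_pmf_def by (metis inv_closed m_closed)
  qed
  have "ell2_inner (carrier G) (?T F) F' = (\<Sum>x\<in>?Z. ?T F x * cnj (F' x))"
    using Y W by (intro ell2_inner_finite) auto
  also have "\<dots> = (\<Sum>x\<in>?Z. \<Sum>z\<in>?Z. F z * (cnj (F' x) * complex_of_real (pmf p (inv x \<otimes> z))))"
  proof (rule sum.cong[OF refl])
    fix x assume x: "x \<in> ?Z"
    then have "?T F x * cnj (F' x) =
        (\<Sum>z\<in>?Z. F z * complex_of_real (pmf p (inv z \<otimes> x)) * cnj (F' x))"
      using T[of F x] Y W by (auto simp: sum_distrib_right)
    also have "\<dots> = (\<Sum>z\<in>?Z. F z * (cnj (F' x) * complex_of_real (pmf p (inv x \<otimes> z))))"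
      by (rule sum.cong[OF refl]) (use sym[OF _ x] in \<open>simp add: mult_ac\<close>)
    finally show "?T F x * cnj (F' x) =
      (\<Sum>z\<in>?Z. F z * (cnj (F' x) * complex_of_real (pmf p (inv x \<otimes> z))))" .
  qed
  also have "\<dots> = (\<Sum>z\<in>?Z. \<Sum>x\<in>?Z. F z * (cnj (F' x) * complex_of_real (pmf p (inv x \<otimes> z))))"
    by (rule sum.swap)
  also have "\<dots> = (\<Sum>z\<in>?Z. F z * cnj (?T F' z))"
    using T[of F'] Y W by (intro sum.cong) (auto simp: sum_distrib_left)
  also have "\<dots> = ell2_inner (carrier G) F (?T F')"
    using Y W by (intro ell2_inner_finite[symmetric]) auto
  finally show ?thesis .
qed

section \<open>The switch-walk-switch kernel\<close>

text \<open>The identity is kept out of the support so that each step leaves its site: the two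
  switches then act on different lamps, and a step is determined by its end points.\<close>

locale lamplighter_walk = G: group G + H: group H
  for G :: "('g, 'a) monoid_scheme" and H :: "('h, 'b) monoid_scheme" +
  fixes \<mu> :: "'g pmf"
  assumes finite_H: "finite (carrier H)"
    and finite_supp: "finite (set_pmf \<mu>)"
    and supp_subset: "set_pmf \<mu> \<subseteq> carrier G - {\<one>\<^bsub>G\<^esub>}"
    and symmetric_mu: "symmetric_pmf G \<mu>"
begin

abbreviation configs :: "('g \<Rightarrow> 'h) set" where
  "configs \<equiv> carrier (lamp_configs G H)"

abbreviation "LL \<equiv> lamplighter H G"

abbreviation "P \<equiv> transition_operator LL (switch_walk_switch H G \<mu>)"

abbreviation n :: real where "n \<equiv> real (card (carrier H))"

sublocale LL: group LL
  using G.group_axioms H.group_axioms by (rule group_lamplighter)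

lemma n_pos: "n > 0"
  using finite_H H.one_closed by (auto simp: card_gt_0_iff)

lemma configs_iff:
  "\<eta> \<in> configs \<longleftrightarrow> \<eta> \<in> carrier G \<rightarrow>\<^sub>E carrier H \<and> finite {x \<in> carrier G. \<eta> x \<noteq> \<one>\<^bsub>H\<^esub>}"
  using H.group_axioms by (auto simp: lamp_configs_def carrier_sum_group)

lemma configs_val: "\<eta> \<in> configs \<Longrightarrow> x \<in> carrier G \<Longrightarrow> \<eta> x \<in> carrier H"
  by (auto simp: configs_iff)

lemma configs_eqI:
  assumes "\<eta> \<in> configs" "\<zeta> \<in> configs" "\<And>x. x \<in> carrier G \<Longrightarrow> \<eta> x = \<zeta> x"
  shows "\<eta> = \<zeta>"
  using assms by (auto simp: configs_iff intro: PiE_ext)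

lemma restrict_eq_config_iff:
  assumes "\<eta> \<in> configs"
  shows "restrict f (carrier G) = \<eta> \<longleftrightarrow> (\<forall>x\<in>carrier G. f x = \<eta> x)"
proof
  assume "\<forall>x\<in>carrier G. f x = \<eta> x"
  then show "restrict f (carrier G) = \<eta>"
    using assms by (intro extensionalityI[of _ "carrier G"]) (auto simp: configs_iff PiE_iff)
qed auto

lemma configs_upd:
  assumes "\<eta> \<in> configs" "g \<in> carrier G" "a \<in> carrier H"
  shows "\<eta>(g := a) \<in> configs"
proof -
  have "{x \<in> carrier G. (\<eta>(g := a)) x \<noteq> \<one>\<^bsub>H\<^esub>} \<subseteq> insert g {x \<in> carrier G. \<eta> x \<noteq> \<one>\<^bsub>H\<^esub>}" by auto
  then have "finite {x \<in> carrier G. (\<eta>(g := a)) x \<noteq> \<one>\<^bsub>H\<^esub>}"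
    using assms by (rule_tac finite_subset) (auto simp: configs_iff)
  then show ?thesis using assms by (auto simp: configs_iff PiE_iff extensional_def)
qed

lemma carrier_LL: "carrier LL = configs \<times> carrier G"
  by (simp add: lamplighter_def)

lemma mult_LL:
  "(\<eta>, g) \<otimes>\<^bsub>LL\<^esub> (\<zeta>, h) =
   (\<lambda>x\<in>carrier G. \<eta> x \<otimes>\<^bsub>H\<^esub> translate G g \<zeta> x, g \<otimes>\<^bsub>G\<^esub> h)"
  by (simp add: lamplighter_def sum_group_const_mult)

lemma one_configs: "\<one>\<^bsub>lamp_configs G H\<^esub> = (\<lambda>x\<in>carrier G. \<one>\<^bsub>H\<^esub>)"
  by (simp add: lamp_configs_def sum_group_def product_group_def)

definition move :: "('h \<times> 'g) \<times> 'h \<Rightarrow> ('g \<Rightarrow> 'h) \<times> 'g" where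
  "move = (\<lambda>((h, s), h').
    embed_lamp H G h \<otimes>\<^bsub>LL\<^esub> embed_base H G s \<otimes>\<^bsub>LL\<^esub> embed_lamp H G h')"

abbreviation moves :: "(('h \<times> 'g) \<times> 'h) pmf" where
  "moves \<equiv> pair_pmf (pair_pmf (pmf_of_set (carrier H)) \<mu>) (pmf_of_set (carrier H))"

lemma switch_walk_switch_eq: "switch_walk_switch H G \<mu> = map_pmf move moves"
  by (simp add: switch_walk_switch_def pmf_convolution_def pair_map_pmf1 pair_map_pmf2
      map_pmf_comp move_def Let_def apfst_def apsnd_def map_prod_def case_prod_unfold)

lemma set_moves: "set_pmf moves = (carrier H \<times> set_pmf \<mu>) \<times> carrier H"
proof -
  have "set_pmf (pmf_of_set (carrier H)) = carrier H"
    using finite_H H.one_closed by (intro set_pmf_of_set) auto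
  then show ?thesis by simp
qed

lemma move_eq:
  assumes "h \<in> carrier H" "h' \<in> carrier H" "s \<in> carrier G" "s \<noteq> \<one>\<^bsub>G\<^esub>"
  shows "move ((h, s), h') =
    (\<lambda>x\<in>carrier G. if x = \<one>\<^bsub>G\<^esub> then h else if x = s then h' else \<one>\<^bsub>H\<^esub>, s)"
proof -
  have "inv\<^bsub>G\<^esub> s \<otimes>\<^bsub>G\<^esub> x = \<one>\<^bsub>G\<^esub> \<longleftrightarrow> x = s" if "x \<in> carrier G" for x
    using that assms by (metis G.inv_closed G.inv_equality G.inv_inv G.l_inv)
  then show ?thesis
    using assms
    by (auto simp: move_def embed_lamp_def embed_base_def mult_LL one_configs translate_def fun_eq_iff)
qed

lemma finite_set_sws: "finite (set_pmf (switch_walk_switch H G \<mu>))"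
  unfolding switch_walk_switch_eq set_map_pmf set_moves using finite_H finite_supp by simp

text \<open>For given end points the two switches and the walk step are forced, and they exist only
  if the configurations agree away from \<open>c\<close> and \<open>g\<close>. All outcomes at these
  two lamps have equal weight, so the kernel is that of \<mu> times uniform averaging at both
  sites.\<close>

lemma kernel:
  assumes z: "\<zeta> \<in> configs" "c \<in> carrier G" and x: "\<eta> \<in> configs" "g \<in> carrier G"
  shows "pmf (switch_walk_switch H G \<mu>) (inv\<^bsub>LL\<^esub> (\<zeta>, c) \<otimes>\<^bsub>LL\<^esub> (\<eta>, g)) =
    (if \<forall>y\<in>carrier G - {c, g}. \<zeta> y = \<eta> y then pmf \<mu> (inv\<^bsub>G\<^esub> c \<otimes>\<^bsub>G\<^esub> g) / n\<^sup>2 else 0)"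
proof -
  \<comment> \<open>The only possible step from \<open>(\<zeta>, c)\<close> to
    \<open>(\<eta>, g)\<close>.\<close>
  define pt where "pt = ((inv\<^bsub>H\<^esub> \<zeta> c \<otimes>\<^bsub>H\<^esub> \<eta> c, inv\<^bsub>G\<^esub> c \<otimes>\<^bsub>G\<^esub> g), inv\<^bsub>H\<^esub> \<zeta> g \<otimes>\<^bsub>H\<^esub> \<eta> g)"
  define agree where "agree \<longleftrightarrow> (\<forall>y\<in>carrier G - {c, g}. \<zeta> y = \<eta> y)"
  have eqv: "move \<omega> = inv\<^bsub>LL\<^esub> (\<zeta>, c) \<otimes>\<^bsub>LL\<^esub> (\<eta>, g) \<longleftrightarrow> \<omega> = pt \<and> agree"
    if mem: "\<omega> \<in> set_pmf moves" for \<omega>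
  proof -
    obtain h s h' where \<omega>: "\<omega> = ((h, s), h')" "h \<in> carrier H" "h' \<in> carrier H" "s \<in> set_pmf \<mu>"
      using mem set_moves by auto
    then have s: "s \<in> carrier G" "s \<noteq> \<one>\<^bsub>G\<^esub>" using supp_subset by auto
    have cs: "c \<otimes>\<^bsub>G\<^esub> s \<noteq> c" using s z by simp
    have inv1: "inv\<^bsub>G\<^esub> c \<otimes>\<^bsub>G\<^esub> y = \<one>\<^bsub>G\<^esub> \<longleftrightarrow> y = c" if "y \<in> carrier G" for y
      using that z by (metis G.inv_closed G.inv_equality G.inv_inv G.l_inv)
    have inv2: "inv\<^bsub>G\<^esub> c \<otimes>\<^bsub>G\<^esub> y = s \<longleftrightarrow> y = c \<otimes>\<^bsub>G\<^esub> s" if "y \<in> carrier G" for y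
      using that z s by (metis G.inv_solve_left)
    have mv: "move \<omega> \<in> carrier LL"
      using \<omega> s
      by (auto simp: move_eq carrier_LL configs_iff intro: finite_subset[of _ "{\<one>\<^bsub>G\<^esub>, s}"])
    have zx: "(\<zeta>, c) \<in> carrier LL" "(\<eta>, g) \<in> carrier LL" using z x by (simp_all add: carrier_LL)
    have "move \<omega> = inv\<^bsub>LL\<^esub> (\<zeta>, c) \<otimes>\<^bsub>LL\<^esub> (\<eta>, g) \<longleftrightarrow> (\<zeta>, c) \<otimes>\<^bsub>LL\<^esub> move \<omega> = (\<eta>, g)"
      unfolding LL.inv_solve_left[OF mv zx] by (rule eq_commute)
    also have "(\<zeta>, c) \<otimes>\<^bsub>LL\<^esub> move \<omega> =
        (\<lambda>y\<in>carrier G. \<zeta> y \<otimes>\<^bsub>H\<^esub> (if y = c then h else if y = c \<otimes>\<^bsub>G\<^esub> s then h' else \<one>\<^bsub>H\<^esub>), c \<otimes>\<^bsub>G\<^esub> s)"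
      using \<omega> s z inv1 inv2 by (auto simp: move_eq mult_LL translate_def fun_eq_iff)
    also have "\<dots> = (\<eta>, g) \<longleftrightarrow> g = c \<otimes>\<^bsub>G\<^esub> s \<and> (\<forall>y\<in>carrier G.
        \<zeta> y \<otimes>\<^bsub>H\<^esub> (if y = c then h else if y = c \<otimes>\<^bsub>G\<^esub> s then h' else \<one>\<^bsub>H\<^esub>) = \<eta> y)"
      using restrict_eq_config_iff[OF x(1)] by auto
    also have "\<dots> \<longleftrightarrow> g = c \<otimes>\<^bsub>G\<^esub> s \<and> agree \<and> \<zeta> c \<otimes>\<^bsub>H\<^esub> h = \<eta> c \<and> \<zeta> g \<otimes>\<^bsub>H\<^esub> h' = \<eta> g"
      using cs z x configs_val[OF z(1)] by (auto simp: agree_def)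
    also have "\<dots> \<longleftrightarrow> \<omega> = pt \<and> agree"
      using \<omega> s z x configs_val H.inv_solve_left[of h "\<zeta> c" "\<eta> c"] H.inv_solve_left[of h' "\<zeta> g" "\<eta> g"]
        G.inv_solve_left[of s c g]
      by (auto simp: pt_def)
    finally show ?thesis .
  qed
  \<comment> \<open>Intersecting with the support makes \<open>eqv\<close> applicable; the
    intersection is dropped again once the event is reduced to \<open>pt\<close>.\<close>
  have "pmf (switch_walk_switch H G \<mu>) (inv\<^bsub>LL\<^esub> (\<zeta>, c) \<otimes>\<^bsub>LL\<^esub> (\<eta>, g)) =
    measure (measure_pmf moves) (move -` {inv\<^bsub>LL\<^esub> (\<zeta>, c) \<otimes>\<^bsub>LL\<^esub> (\<eta>, g)} \<inter> set_pmf moves)"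
    unfolding switch_walk_switch_eq pmf_map measure_Int_set_pmf ..
  also have "move -` {inv\<^bsub>LL\<^esub> (\<zeta>, c) \<otimes>\<^bsub>LL\<^esub> (\<eta>, g)} \<inter> set_pmf moves =
    (if agree then {pt} else {}) \<inter> set_pmf moves"
    using eqv by auto
  also have "measure (measure_pmf moves) \<dots> = (if agree then pmf moves pt else 0)"
    unfolding measure_Int_set_pmf by (simp add: measure_pmf_single)
  also have "pmf moves pt = pmf \<mu> (inv\<^bsub>G\<^esub> c \<otimes>\<^bsub>G\<^esub> g) / n\<^sup>2"
  proof -
    have "pmf (pmf_of_set (carrier H)) a = 1 / n" if "a \<in> carrier H" for a
      using that finite_H by (subst pmf_of_set) auto
    then show ?thesis
      using z x configs_val by (simp add: pt_def pmf_pair power2_eq_square)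
  qed
  finally show ?thesis by (simp add: agree_def)
qed

text \<open>The weights of an element and of its inverse are the kernel values between this element
  and the identity in the two directions; the kernel formula is symmetric because \<mu> is.\<close>

lemma symmetric_sws: "symmetric_pmf LL (switch_walk_switch H G \<mu>)"
  unfolding symmetric_pmf_def
proof
  fix x assume "x \<in> carrier LL"
  then obtain \<eta> g where x: "x = (\<eta>, g)" "\<eta> \<in> configs" "g \<in> carrier G" by (auto simp: carrier_LL)
  obtain \<iota> where i: "\<one>\<^bsub>LL\<^esub> = (\<iota>, \<one>\<^bsub>G\<^esub>)" "\<iota> \<in> configs"
    using LL.one_closed by (auto simp: lamplighter_def)
  have "pmf (switch_walk_switch H G \<mu>) (inv\<^bsub>LL\<^esub> x) =
      pmf (switch_walk_switch H G \<mu>) (inv\<^bsub>LL\<^esub> (\<eta>, g) \<otimes>\<^bsub>LL\<^esub> (\<iota>, \<one>\<^bsub>G\<^esub>))"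
    using \<open>x \<in> carrier LL\<close> x(1) by (simp flip: i(1))
  also have "\<dots> = pmf (switch_walk_switch H G \<mu>) (inv\<^bsub>LL\<^esub> (\<iota>, \<one>\<^bsub>G\<^esub>) \<otimes>\<^bsub>LL\<^esub> (\<eta>, g))"
    using x i symmetric_mu by (auto simp: kernel symmetric_pmf_def)
  also have "\<dots> = pmf (switch_walk_switch H G \<mu>) x"
    using \<open>x \<in> carrier LL\<close> x(1) by (simp flip: i(1))
  finally show "pmf (switch_walk_switch H G \<mu>) (inv\<^bsub>LL\<^esub> x) = pmf (switch_walk_switch H G \<mu>) x" .
qed

text \<open>The tensor product of the lamp function \<open>f\<close> with the point mass at position
  \<open>c\<close>.\<close>

definition tensor :: "(('g \<Rightarrow> 'h) \<Rightarrow> real) \<Rightarrow> 'g \<Rightarrow> ('g \<Rightarrow> 'h) \<times> 'g \<Rightarrow> complex" where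
  "tensor f c = (\<lambda>(\<eta>, g). complex_of_real (f \<eta> * of_bool (g = c)))"

lemma P_tensor:
  assumes "c \<in> carrier G" "\<eta> \<in> configs" "g \<in> carrier G"
  shows "P (tensor f c) (\<eta>, g) = complex_of_real (pmf \<mu> (inv\<^bsub>G\<^esub> c \<otimes>\<^bsub>G\<^esub> g) / n\<^sup>2 *
    (\<Sum>a\<in>carrier H. \<Sum>b\<in>carrier H. f (\<eta>(g := a, c := b))))"
proof (cases "g = c")
  case True

  \<comment> \<open>For \<open>g = c\<close> both sides vanish, since the walk never stays
    put.\<close>
  have mu1: "pmf \<mu> \<one>\<^bsub>G\<^esub> = 0" using supp_subset by (auto simp: set_pmf_iff)
  have x: "(\<eta>, g) \<in> carrier LL" using assms by (simp add: carrier_LL)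
  have "P (tensor f c) (\<eta>, g) = (\<Sum>\<^sub>\<infinity>z\<in>carrier LL. 0)"
    unfolding LL.transition_operator_kernel[OF x]
  proof (rule infsum_cong)
    fix z assume "z \<in> carrier LL"
    then obtain \<zeta> k where "z = (\<zeta>, k)" "\<zeta> \<in> configs" "k \<in> carrier G" by (auto simp: carrier_LL)
    then show "tensor f c z * complex_of_real (pmf (switch_walk_switch H G \<mu>)
        (inv\<^bsub>LL\<^esub> z \<otimes>\<^bsub>LL\<^esub> (\<eta>, g))) = 0"
      using assms True mu1 by (cases "k = c") (auto simp: tensor_def kernel)
  qed
  then show ?thesis using True assms mu1 by simp
next
  case False
  let ?p = "pmf \<mu> (inv\<^bsub>G\<^esub> c \<otimes>\<^bsub>G\<^esub> g) / n\<^sup>2"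
  let ?u = "\<lambda>(a, b). (\<eta>(g := a, c := b), c)"
  \<comment> \<open>The two updates act on different sites, so each pair of lamp values is counted
    once.\<close>
  have inj: "inj_on ?u (carrier H \<times> carrier H)"
    using False by (auto simp: inj_on_def) (metis fun_upd_apply)+
  have x: "(\<eta>, g) \<in> carrier LL" using assms by (simp add: carrier_LL)
  have sub: "?u ` (carrier H \<times> carrier H) \<subseteq> carrier LL"
    using assms configs_upd by (auto simp: carrier_LL)
  have "P (tensor f c) (\<eta>, g) =
      (\<Sum>\<^sub>\<infinity>z\<in>?u ` (carrier H \<times> carrier H). complex_of_real (f (fst z) * ?p))"
    unfolding LL.transition_operator_kernel[OF x]
  proof (rule infsum_cong_neutral)
    fix z assume "z \<in> carrier LL - ?u ` (carrier H \<times> carrier H)"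
    then obtain \<zeta> k where z: "z = (\<zeta>, k)" "\<zeta> \<in> configs" "k \<in> carrier G"
      "z \<notin> ?u ` (carrier H \<times> carrier H)" by (auto simp: carrier_LL)
    have "\<exists>y\<in>carrier G - {c, g}. \<zeta> y \<noteq> \<eta> y" if "k = c"
    proof (rule ccontr)
      assume "\<not> ?thesis"
      \<comment> \<open>A configuration agreeing with \<eta> away from \<open>c\<close> and
        \<open>g\<close> arises from it by inserting its own two values there.\<close>
      then have "\<zeta> = \<eta>(g := \<zeta> g, c := \<zeta> c)"
        using assms z configs_val by (intro configs_eqI configs_upd) auto
      then have "z = ?u (\<zeta> g, \<zeta> c)" using z that by simp
      then show False using z assms configs_val by blast
    qed
    then show "tensor f c z * complex_of_real (pmf (switch_walk_switch H G \<mu>)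
        (inv\<^bsub>LL\<^esub> z \<otimes>\<^bsub>LL\<^esub> (\<eta>, g))) = 0"
      using z assms by (cases "k = c") (auto simp: tensor_def kernel)
  next
    fix z assume "z \<in> carrier LL \<inter> ?u ` (carrier H \<times> carrier H)"
    then obtain a b where "z = (\<eta>(g := a, c := b), c)" "a \<in> carrier H" "b \<in> carrier H" by auto
    then show "tensor f c z * complex_of_real (pmf (switch_walk_switch H G \<mu>)
        (inv\<^bsub>LL\<^esub> z \<otimes>\<^bsub>LL\<^esub> (\<eta>, g))) = complex_of_real (f (fst z) * ?p)"
      using assms by (simp add: tensor_def kernel configs_upd)
  qed (use sub in auto)
  also have "\<dots> = (\<Sum>ab\<in>carrier H \<times> carrier H. complex_of_real (f (fst (?u ab)) * ?p))"
    using finite_H by (subst infsum_finite) (auto simp: sum.reindex[OF inj])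
  also have "\<dots> = complex_of_real (\<Sum>(a, b)\<in>carrier H \<times> carrier H. f (\<eta>(g := a, c := b)) * ?p)"
    by (simp add: case_prod_unfold)
  also have "\<dots> = complex_of_real (?p * (\<Sum>a\<in>carrier H. \<Sum>b\<in>carrier H. f (\<eta>(g := a, c := b))))"
    unfolding sum_distrib_left sum.cartesian_product by (simp only: case_prod_unfold mult.commute)
  finally show ?thesis .
qed

section \<open>Lamp functions split along finite sets of sites\<close>

text \<open>
  The tensor product expansion of the point mass at \<open>\<eta>0\<close>: at each site of \<open>B\<close> the point mass is
  split into its mean (the constant \<open>1 / n\<close>, chosen at the sites in \<open>D\<close>) and the remainder with
  mean zero (chosen at the sites in \<open>B - D\<close>).
\<close>

definition split_mass :: "('g \<Rightarrow> 'h) \<Rightarrow> 'g set \<Rightarrow> 'g set \<Rightarrow> ('g \<Rightarrow> 'h) \<Rightarrow> real" where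
  "split_mass \<eta>0 B D \<eta> =
    (if \<eta> \<in> configs \<and> (\<forall>x\<in>carrier G - B. \<eta> x = \<eta>0 x)
     then (\<Prod>x\<in>D. 1 / n) * (\<Prod>x\<in>B - D. of_bool (\<eta> x = \<eta>0 x) - 1 / n) else 0)"

definition local_configs :: "('g \<Rightarrow> 'h) \<Rightarrow> 'g set \<Rightarrow> ('g \<Rightarrow> 'h) set" where
  "local_configs \<eta>0 B = {\<eta> \<in> configs. \<forall>x\<in>carrier G - B. \<eta> x = \<eta>0 x}"

context
  fixes \<eta>0 :: "'g \<Rightarrow> 'h" and B :: "'g set"
  assumes \<eta>0: "\<eta>0 \<in> configs" and B: "finite B" "B \<subseteq> carrier G"
begin

lemma finite_local_configs: "finite (local_configs \<eta>0 B)"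
proof (rule finite_subset)
  show "local_configs \<eta>0 B \<subseteq> (\<lambda>\<rho> x. if x \<in> B then \<rho> x else \<eta>0 x) ` (B \<rightarrow>\<^sub>E carrier H)"
  proof
    fix \<eta> assume "\<eta> \<in> local_configs \<eta>0 B"
    then have \<eta>: "\<eta> \<in> configs" "\<And>x. x \<in> carrier G - B \<Longrightarrow> \<eta> x = \<eta>0 x"
      by (auto simp: local_configs_def)
    have "\<eta> x = \<eta>0 x" if "x \<notin> B" for x
      using \<eta> \<eta>0 that by (cases "x \<in> carrier G") (auto simp: configs_iff PiE_iff extensional_def)
    then have "\<eta> = (\<lambda>x. if x \<in> B then restrict \<eta> B x else \<eta>0 x)" by auto
    moreover have "restrict \<eta> B \<in> B \<rightarrow>\<^sub>E carrier H" using \<eta>(1) B configs_val by auto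
    ultimately show "\<eta> \<in> (\<lambda>\<rho> x. if x \<in> B then \<rho> x else \<eta>0 x) ` (B \<rightarrow>\<^sub>E carrier H)" by blast
  qed
  show "finite ((\<lambda>\<rho> x. if x \<in> B then \<rho> x else \<eta>0 x) ` (B \<rightarrow>\<^sub>E carrier H))"
    using B finite_H by (intro finite_imageI finite_PiE) auto
qed

lemma base_local: "\<eta>0 \<in> local_configs \<eta>0 B"
  using \<eta>0 by (simp add: local_configs_def)

lemma local_configs_upd:
  "\<eta> \<in> local_configs \<eta>0 B \<Longrightarrow> x \<in> B \<Longrightarrow> a \<in> carrier H \<Longrightarrow> \<eta>(x := a) \<in> local_configs \<eta>0 B"
  using B configs_upd by (auto simp: local_configs_def)

lemma split_mass_outside: "\<eta> \<notin> local_configs \<eta>0 B \<Longrightarrow> split_mass \<eta>0 B D \<eta> = 0"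
  by (auto simp: split_mass_def local_configs_def)

lemma split_mass_local:
  "\<eta> \<in> local_configs \<eta>0 B \<Longrightarrow> split_mass \<eta>0 B D \<eta> =
    (\<Prod>x\<in>D. 1 / n) * (\<Prod>x\<in>B - D. of_bool (\<eta> x = \<eta>0 x) - 1 / n)"
  by (simp add: split_mass_def local_configs_def)

lemma local_configs_upd_iff:
  assumes "\<eta> \<in> configs" "x \<in> B" "a \<in> carrier H"
  shows "\<eta>(x := a) \<in> local_configs \<eta>0 B \<longleftrightarrow> \<eta> \<in> local_configs \<eta>0 B"
  using assms configs_upd[of \<eta> x a] B by (auto simp: local_configs_def)

lemma split_mass_invariant:
  assumes "D \<subseteq> B" "\<eta> \<in> configs" "x \<in> D" "a \<in> carrier H"
  shows "split_mass \<eta>0 B D (\<eta>(x := a)) = split_mass \<eta>0 B D \<eta>"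
proof (cases "\<eta> \<in> local_configs \<eta>0 B")
  case True
  then have "\<eta>(x := a) \<in> local_configs \<eta>0 B" using assms local_configs_upd by auto
  moreover have "(\<Prod>y\<in>B - D. of_bool ((\<eta>(x := a)) y = \<eta>0 y) - 1 / n) =
      (\<Prod>y\<in>B - D. of_bool (\<eta> y = \<eta>0 y) - 1 / n)"
    using assms by (intro prod.cong) auto
  ultimately show ?thesis using True by (simp only: split_mass_local)
next
  case False
  then have "\<eta>(x := a) \<notin> local_configs \<eta>0 B" using assms local_configs_upd_iff by auto
  then show ?thesis using False by (simp add: split_mass_outside)
qed

text \<open>Over the lamp at a closed site, the point mass and the constant \<open>1 / n\<close>
  both have total 1. Together with \<open>split_mass_invariant\<close> this is all that the walk
  operator needs to know about the splitting.\<close>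

lemma split_mass_mean:
  assumes "D \<subseteq> B" "\<eta> \<in> configs" "x \<in> B - D"
  shows "(\<Sum>a\<in>carrier H. split_mass \<eta>0 B D (\<eta>(x := a))) = 0"
proof (cases "\<eta> \<in> local_configs \<eta>0 B")
  case True
  let ?c = "(\<Prod>y\<in>D. 1 / n) * (\<Prod>y\<in>B - D - {x}. of_bool (\<eta> y = \<eta>0 y) - 1 / n)"
  have "split_mass \<eta>0 B D (\<eta>(x := a)) = ?c * (of_bool (a = \<eta>0 x) - 1 / n)" if "a \<in> carrier H" for a
  proof -
    have "(\<Prod>y\<in>B - D - {x}. of_bool ((\<eta>(x := a)) y = \<eta>0 y) - 1 / n) =
        (\<Prod>y\<in>B - D - {x}. of_bool (\<eta> y = \<eta>0 y) - 1 / n)"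
      by (intro prod.cong) auto
    then show ?thesis
      using True assms that local_configs_upd[of \<eta> x a] B
        prod.remove[of "B - D" x "\<lambda>y. of_bool ((\<eta>(x := a)) y = \<eta>0 y) - 1 / n"]
      by (simp add: split_mass_local)
  qed
  then have "(\<Sum>a\<in>carrier H. split_mass \<eta>0 B D (\<eta>(x := a))) =
      ?c * (\<Sum>a\<in>carrier H. of_bool (a = \<eta>0 x) - 1 / n)"
    by (simp add: sum_distrib_left)
  also have "(\<Sum>a\<in>carrier H. of_bool (a = \<eta>0 x) - 1 / n) = 0"
  proof -
    have "\<eta>0 x \<in> carrier H" using configs_val \<eta>0 assms B by auto
    then have "(\<Sum>a\<in>carrier H. of_bool (a = \<eta>0 x) :: real) = 1"
      using finite_H by (simp add: of_bool_def sum.delta)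
    then show ?thesis using n_pos by (simp add: sum_subtractf)
  qed
  finally show ?thesis by (simp only: mult_zero_right)
next
  case False
  have "split_mass \<eta>0 B D (\<eta>(x := a)) = 0" if "a \<in> carrier H" for a
    using False that assms local_configs_upd_iff[of \<eta> x a] by (auto intro: split_mass_outside)
  then show ?thesis by simp
qed

text \<open>Expanding the product of the sums mean plus remainder over the sites of \<open>B\<close>
  gives one term for each set \<open>D\<close>.\<close>

lemma split_mass_sum:
  "(\<Sum>D\<in>Pow B. split_mass \<eta>0 B D \<eta>) = of_bool (\<eta> = \<eta>0)"
proof (cases "\<eta> \<in> local_configs \<eta>0 B")
  case True
  have "(\<Sum>D\<in>Pow B. split_mass \<eta>0 B D \<eta>) =
      (\<Prod>x\<in>B. 1 / n + (of_bool (\<eta> x = \<eta>0 x) - 1 / n))"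
    using True prod_add[OF B(1), of "\<lambda>_. 1 / n" "\<lambda>x. of_bool (\<eta> x = \<eta>0 x) - 1 / n"]
    by (simp add: split_mass_local)
  also have "\<dots> = (\<Prod>x\<in>B. of_bool (\<eta> x = \<eta>0 x))" by simp
  also have "\<dots> = of_bool (\<forall>x\<in>B. \<eta> x = \<eta>0 x)"
    using B(1) by (induction B) auto
  also have "(\<forall>x\<in>B. \<eta> x = \<eta>0 x) \<longleftrightarrow> \<eta> = \<eta>0"
    using True \<eta>0 by (auto simp: local_configs_def intro!: configs_eqI)
  finally show ?thesis .
next
  case False
  then have "\<eta> \<noteq> \<eta>0" using base_local by auto
  then show ?thesis using False by (simp add: split_mass_outside)
qed

text \<open>At the base configuration an open site contributes \<open>1 / n\<close> and a closed one
  \<open>1 - 1 / n\<close>; this is where the percolation weights come from.\<close>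

lemma split_mass_base:
  assumes "D \<subseteq> B"
  shows "split_mass \<eta>0 B D \<eta>0 = bernoulli_weight (1 / n) B D"
  using base_local by (simp add: split_mass_local bernoulli_weight_def)

text \<open>Exchanging the lamp at \<open>x\<close> with the extra value \<open>a\<close> is an
  involution of the pairs, so resampling one lamp leaves the sum invariant up to the factor
  \<open>n\<close>.\<close>

lemma sum_local_configs_average:
  assumes "x \<in> B"
  shows "(\<Sum>\<eta>\<in>local_configs \<eta>0 B. \<Sum>a\<in>carrier H. k (\<eta>(x := a))) =
    n * (\<Sum>\<eta>\<in>local_configs \<eta>0 B. k \<eta>)"
proof -
  have val: "\<eta> x \<in> carrier H" if "\<eta> \<in> local_configs \<eta>0 B" for \<eta>
    using that assms B configs_val by (auto simp: local_configs_def)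
  have "(\<Sum>\<eta>\<in>local_configs \<eta>0 B. \<Sum>a\<in>carrier H. k (\<eta>(x := a))) =
    (\<Sum>(\<eta>, a)\<in>local_configs \<eta>0 B \<times> carrier H. k (\<eta>(x := a)))"
    by (rule sum.cartesian_product)
  also have "\<dots> = (\<Sum>(\<eta>, a)\<in>local_configs \<eta>0 B \<times> carrier H. k \<eta>)"
    by (rule sum.reindex_bij_witness[of _ "\<lambda>(\<eta>, a). (\<eta>(x := a), \<eta> x)" "\<lambda>(\<eta>, a). (\<eta>(x := a), \<eta> x)"])
      (use val local_configs_upd assms in auto)
  also have "\<dots> = n * (\<Sum>\<eta>\<in>local_configs \<eta>0 B. k \<eta>)"
    by (simp add: sum.cartesian_product[symmetric] sum_distrib_left)
  finally show ?thesis .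
qed

text \<open>Resample the lamp at a site lying in exactly one of \<open>D\<close> and
  \<open>D'\<close>: one factor does not depend on it, and the other has mean zero there.\<close>

lemma split_mass_orthogonal:
  assumes "D \<subseteq> B" "D' \<subseteq> B" "D \<noteq> D'"
  shows "(\<Sum>\<eta>\<in>local_configs \<eta>0 B. split_mass \<eta>0 B D \<eta> * split_mass \<eta>0 B D' \<eta>) = 0"
proof -
  have *: "(\<Sum>\<eta>\<in>local_configs \<eta>0 B. split_mass \<eta>0 B D \<eta> * split_mass \<eta>0 B D' \<eta>) = 0"
    if D: "D \<subseteq> B" "D' \<subseteq> B" "x \<in> D" "x \<notin> D'" for D D' x
  proof -
    have "n * (\<Sum>\<eta>\<in>local_configs \<eta>0 B. split_mass \<eta>0 B D \<eta> * split_mass \<eta>0 B D' \<eta>) =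
      (\<Sum>\<eta>\<in>local_configs \<eta>0 B. \<Sum>a\<in>carrier H.
        split_mass \<eta>0 B D (\<eta>(x := a)) * split_mass \<eta>0 B D' (\<eta>(x := a)))"
      using D by (intro sum_local_configs_average[symmetric]) auto
    also have "\<dots> = (\<Sum>\<eta>\<in>local_configs \<eta>0 B. 0)"
    proof (rule sum.cong[OF refl])
      fix \<eta> assume "\<eta> \<in> local_configs \<eta>0 B"
      then have \<eta>: "\<eta> \<in> configs" by (simp add: local_configs_def)
      have "(\<Sum>a\<in>carrier H. split_mass \<eta>0 B D (\<eta>(x := a)) * split_mass \<eta>0 B D' (\<eta>(x := a))) =
        split_mass \<eta>0 B D \<eta> * (\<Sum>a\<in>carrier H. split_mass \<eta>0 B D' (\<eta>(x := a)))"
        using D \<eta> by (simp add: split_mass_invariant sum_distrib_left)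
      then show "(\<Sum>a\<in>carrier H. split_mass \<eta>0 B D (\<eta>(x := a)) * split_mass \<eta>0 B D' (\<eta>(x := a))) = 0"
        using D \<eta> split_mass_mean[of D' \<eta> x] by auto
    qed
    finally show ?thesis using n_pos by simp
  qed
  obtain x where "x \<in> D \<and> x \<notin> D' \<or> x \<in> D' \<and> x \<notin> D" using assms(3) by blast
  then show ?thesis
    using *[of D D' x] *[of D' D x] assms by (auto simp: mult.commute)
qed

text \<open>
  Orthogonality turns the squared norm of each summand into its inner product with the point mass
  at \<open>\<eta>0\<close>, that is, into its value there.
\<close>

lemma split_mass_norm:
  assumes "\<D> \<subseteq> Pow B"
  shows "(\<Sum>\<eta>\<in>local_configs \<eta>0 B. (\<Sum>D\<in>\<D>. split_mass \<eta>0 B D \<eta>)\<^sup>2) =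
    (\<Sum>D\<in>\<D>. bernoulli_weight (1 / n) B D)"
proof -
  let ?f = "split_mass \<eta>0 B" and ?\<Omega> = "local_configs \<eta>0 B"
  have fin: "finite (Pow B)" using B by simp
  have "(\<Sum>\<eta>\<in>?\<Omega>. (\<Sum>D\<in>\<D>. ?f D \<eta>)\<^sup>2) = (\<Sum>\<eta>\<in>?\<Omega>. \<Sum>D\<in>\<D>. \<Sum>D'\<in>\<D>. ?f D \<eta> * ?f D' \<eta>)"
    by (simp add: power2_eq_square sum_product)
  also have "\<dots> = (\<Sum>D\<in>\<D>. \<Sum>\<eta>\<in>?\<Omega>. \<Sum>D'\<in>\<D>. ?f D \<eta> * ?f D' \<eta>)" by (rule sum.swap)
  also have "\<dots> = (\<Sum>D\<in>\<D>. \<Sum>D'\<in>\<D>. \<Sum>\<eta>\<in>?\<Omega>. ?f D \<eta> * ?f D' \<eta>)"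
    by (intro sum.cong[OF refl] sum.swap)
  \<comment> \<open>The added terms vanish by orthogonality; over all of \<open>Pow B\<close> the
    inner sum collapses to the point mass.\<close>
  also have "\<dots> = (\<Sum>D\<in>\<D>. \<Sum>D'\<in>Pow B. \<Sum>\<eta>\<in>?\<Omega>. ?f D \<eta> * ?f D' \<eta>)"
  proof (rule sum.cong[OF refl], rule sum.mono_neutral_left)
    fix D assume "D \<in> \<D>"
    then show "\<forall>D'\<in>Pow B - \<D>. (\<Sum>\<eta>\<in>?\<Omega>. ?f D \<eta> * ?f D' \<eta>) = 0"
      using assms by (intro ballI split_mass_orthogonal) auto
  qed (use assms fin in auto)
  also have "\<dots> = (\<Sum>D\<in>\<D>. \<Sum>\<eta>\<in>?\<Omega>. \<Sum>D'\<in>Pow B. ?f D \<eta> * ?f D' \<eta>)"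
    by (intro sum.cong[OF refl] sum.swap)
  also have "\<dots> = (\<Sum>D\<in>\<D>. \<Sum>\<eta>\<in>?\<Omega>. if \<eta> = \<eta>0 then ?f D \<eta>0 else 0)"
    by (intro sum.cong[OF refl]) (simp add: split_mass_sum flip: sum_distrib_left)
  also have "\<dots> = (\<Sum>D\<in>\<D>. bernoulli_weight (1 / n) B D)"
    using finite_local_configs base_local assms by (intro sum.cong) (auto simp: split_mass_base)
  finally show ?thesis .
qed

section \<open>The walk acting on the split point masses\<close>

lemma tensor_split_mass_finsupp:
  assumes "c \<in> carrier G"
  shows "tensor (split_mass \<eta>0 B D) c \<in> finsupp (carrier LL)"
proof (rule finsuppI[of "local_configs \<eta>0 B \<times> {c}"])
  show "local_configs \<eta>0 B \<times> {c} \<subseteq> carrier LL"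
    using assms by (auto simp: carrier_LL local_configs_def)
  show "tensor (split_mass \<eta>0 B D) c z = 0" if "z \<notin> local_configs \<eta>0 B \<times> {c}" for z
    using that by (cases z) (auto simp: tensor_def split_mass_outside)
qed (use finite_local_configs in auto)

text \<open>The walk averages over the lamp at the site it leaves, and over a closed site this
  average is zero.\<close>

lemma P_tensor_outside:
  assumes "D \<subseteq> B" "c \<in> B - D"
  shows "P (tensor (split_mass \<eta>0 B D) c) = (\<lambda>_. 0)"
proof
  fix z
  show "P (tensor (split_mass \<eta>0 B D) c) z = 0"
  proof (cases "z \<in> carrier LL")
    case True
    then obtain \<eta> g where z: "z = (\<eta>, g)" "\<eta> \<in> configs" "g \<in> carrier G" by (auto simp: carrier_LL)
    have "(\<Sum>a\<in>carrier H. \<Sum>b\<in>carrier H. split_mass \<eta>0 B D (\<eta>(g := a, c := b))) = 0"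
      using assms z split_mass_mean configs_upd by (intro sum.neutral) auto
    then show ?thesis using z assms B by (subst z(1), subst P_tensor) auto
  qed (simp add: transition_operator_def)
qed

text \<open>Averaging at \<open>c\<close> has no effect, as \<open>c\<close> is open; averaging at
  the site entered has none inside \<open>C\<close> and gives zero on the closed boundary. What
  remains is the walk killed on leaving the cluster.\<close>

lemma P_tensor_inside:
  assumes D: "D \<subseteq> B" and C: "C \<subseteq> D" "c \<in> C"
    and boundary: "\<And>s. s \<in> set_pmf \<mu> \<Longrightarrow> c \<otimes>\<^bsub>G\<^esub> s \<in> C \<union> (B - D)"
  shows "P (tensor (split_mass \<eta>0 B D) c) =
    (\<Sum>g\<in>C. (\<lambda>z. complex_of_real (pmf \<mu> (inv\<^bsub>G\<^esub> c \<otimes>\<^bsub>G\<^esub> g)) * tensor (split_mass \<eta>0 B D) g z))"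
proof
  fix z
  let ?f = "split_mass \<eta>0 B D"
  have fin: "finite C" using C D B finite_subset by (metis order_trans)
  have cG: "c \<in> carrier G" using C D B by auto

  show "P (tensor ?f c) z = (\<Sum>g\<in>C. (\<lambda>z. complex_of_real (pmf \<mu> (inv\<^bsub>G\<^esub> c \<otimes>\<^bsub>G\<^esub> g)) * tensor ?f g z)) z"
  proof (cases "z \<in> carrier LL")
    case True
    then obtain \<eta> g where z: "z = (\<eta>, g)" "\<eta> \<in> configs" "g \<in> carrier G" by (auto simp: carrier_LL)
    let ?m = "pmf \<mu> (inv\<^bsub>G\<^esub> c \<otimes>\<^bsub>G\<^esub> g)"
    \<comment> \<open>The sum over the lamp at the open site \<open>c\<close> is a factor
      \<open>n\<close>, cancelling one of the two factors \<open>1 / n\<close> of the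
      kernel.\<close>
    have "(\<Sum>a\<in>carrier H. \<Sum>b\<in>carrier H. ?f (\<eta>(g := a, c := b))) = n * (\<Sum>a\<in>carrier H. ?f (\<eta>(g := a)))"
      using z C D configs_upd by (auto simp: split_mass_invariant sum_distrib_left)
    then have P: "P (tensor ?f c) z = complex_of_real (?m / n * (\<Sum>a\<in>carrier H. ?f (\<eta>(g := a))))"
      using z cG n_pos by (simp add: P_tensor power2_eq_square)
    have "?m / n * (\<Sum>a\<in>carrier H. ?f (\<eta>(g := a))) = (if g \<in> C then ?m * ?f \<eta> else 0)"
    proof (cases "g \<in> C")
      case True
      then show ?thesis
        using C D z n_pos by (auto simp: split_mass_invariant)
    next
      case False
      show ?thesis
      proof (cases "inv\<^bsub>G\<^esub> c \<otimes>\<^bsub>G\<^esub> g \<in> set_pmf \<mu>")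
        case True
        then have "c \<otimes>\<^bsub>G\<^esub> (inv\<^bsub>G\<^esub> c \<otimes>\<^bsub>G\<^esub> g) \<in> C \<union> (B - D)" by (rule boundary)
        then have "g \<in> B - D" using False cG z by (simp flip: G.m_assoc)
        then show ?thesis using False D z by (simp add: split_mass_mean)
      next
        case mu: False
        then show ?thesis using False by (simp add: set_pmf_iff)
      qed
    qed
    also have "\<dots> = (\<Sum>k\<in>C. if k = g then ?m * ?f \<eta> else 0)" using fin by simp
    finally have "P (tensor ?f c) z = (\<Sum>k\<in>C. complex_of_real (if k = g then ?m * ?f \<eta> else 0))"
      using P by simp
    also have "\<dots> = (\<Sum>k\<in>C. complex_of_real (pmf \<mu> (inv\<^bsub>G\<^esub> c \<otimes>\<^bsub>G\<^esub> k)) * tensor ?f k z)"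
      using z by (intro sum.cong) (auto simp: tensor_def)
    finally show ?thesis by (simp only: sum_fun_apply)
  next
    case False
    have "tensor ?f k z = 0" if "k \<in> C" for k
      using that False tensor_split_mass_finsupp[of k D] C D B by (auto simp: finsupp_def)
    then show ?thesis using False by (simp add: sum_fun_apply transition_operator_def)
  qed
qed

text \<open>For an open starting site the lamp factor stays fixed and only the position moves within
  \<open>C\<close>; for a closed one the vector lies in the kernel of \<open>P\<close> and spans an
  invariant space by itself.\<close>

lemma invariant_subspace_if_confined:
  assumes D: "D \<subseteq> B" and r: "r \<in> B"
    and conf: "confined (carrier G) (cayley_edges G (set_pmf \<mu>)) r B D"
  defines "f \<equiv> split_mass \<eta>0 B D"
  shows "\<exists>t. finite t \<and> t \<subseteq> finsupp (carrier LL) \<and> tensor f r \<in> fun_space.span t \<and>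
    (\<forall>F\<in>t. P F \<in> fun_space.span t)"
proof (cases "r \<in> D")
  case False
  have "P (tensor f r) = 0"
    unfolding f_def zero_fun_def by (rule P_tensor_outside) (use D r False in auto)
  moreover have "tensor f r \<in> finsupp (carrier LL)"
    unfolding f_def using r B by (intro tensor_split_mass_finsupp) auto
  ultimately show ?thesis
    by (intro exI[of _ "{tensor f r}"]) (auto simp: fun_space.span_base fun_space.span_zero)
next
  case True
  then obtain C where C: "C \<subseteq> D" "r \<in> C" "\<And>x y. x \<in> C \<Longrightarrow> y \<in> carrier G \<Longrightarrow>
      {x, y} \<in> cayley_edges G (set_pmf \<mu>) \<Longrightarrow> y \<in> C \<union> (B - D)"
    using conf unfolding confined_def by metis
  have fin: "finite C" using C(1) D B finite_subset by (metis order_trans)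
  have "P (tensor f c) \<in> fun_space.span (tensor f ` C)" if c: "c \<in> C" for c
  proof -
    have "c \<in> carrier G" using c C(1) D B by auto
    then have "c \<otimes>\<^bsub>G\<^esub> s \<in> C \<union> (B - D)" if "s \<in> set_pmf \<mu>" for s
      using that supp_subset C(3)[OF c, of "c \<otimes>\<^bsub>G\<^esub> s"] by (force simp: cayley_edges_def)
    then have "P (tensor f c) =
      (\<Sum>g\<in>C. (\<lambda>z. complex_of_real (pmf \<mu> (inv\<^bsub>G\<^esub> c \<otimes>\<^bsub>G\<^esub> g)) * tensor f g z))"
      unfolding f_def using D C(1) c by (intro P_tensor_inside) auto
    then show ?thesis
      by (simp only:) (intro fun_space.span_sum fun_space.span_scale fun_space.span_base imageI)
  qed
  moreover have "tensor f ` C \<subseteq> finsupp (carrier LL)"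
    unfolding f_def using tensor_split_mass_finsupp C(1) D B by blast
  ultimately show ?thesis
    using fin C(2) by (intro exI[of _ "tensor f ` C"]) (auto intro: fun_space.span_base)
qed

end

section \<open>Countability and the passage to the limit of large windows\<close>

lemma countable_configs:
  assumes "countable (carrier G)"
  shows "countable configs"
proof (rule countable_image_inj_on)
  let ?graph = "\<lambda>\<eta>. {(x, \<eta> x) | x. x \<in> carrier G \<and> \<eta> x \<noteq> \<one>\<^bsub>H\<^esub>}"
  have "?graph \<eta> \<in> {A. finite A \<and> A \<subseteq> carrier G \<times> carrier H}" if "\<eta> \<in> configs" for \<eta>
  proof -
    have "?graph \<eta> = (\<lambda>x. (x, \<eta> x)) ` {x \<in> carrier G. \<eta> x \<noteq> \<one>\<^bsub>H\<^esub>}" by auto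
    then show ?thesis using that by (auto simp: configs_iff)
  qed
  moreover have "countable {A. finite A \<and> A \<subseteq> carrier G \<times> carrier H}"
    using assms finite_H by (intro countable_Collect_finite_subset) (auto intro: countable_finite)
  ultimately show "countable (?graph ` configs)"
    by (intro countable_subset[OF image_subsetI])
  show "inj_on ?graph configs"
  proof (rule inj_onI)
    fix \<eta> \<zeta> assume \<eta>: "\<eta> \<in> configs" "\<zeta> \<in> configs" and eq: "?graph \<eta> = ?graph \<zeta>"
    have "\<eta> x = \<zeta> x" if "x \<in> carrier G" for x
    proof -
      \<comment> \<open>Lamps in the identity state are left out of the graph, so the states are
        compared through all possible values \<open>y\<close>; a missing pair means the
        identity.\<close>
      have "(x, y) \<in> ?graph \<eta> \<longleftrightarrow> (x, y) \<in> ?graph \<zeta>" for y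
        by (simp only: eq)
      then have "\<eta> x = y \<and> y \<noteq> \<one>\<^bsub>H\<^esub> \<longleftrightarrow> \<zeta> x = y \<and> y \<noteq> \<one>\<^bsub>H\<^esub>" for y
        using that by auto
      then show ?thesis by metis
    qed
    then show "\<eta> = \<zeta>" using \<eta> configs_eqI by blast
  qed
qed

theorem pure_point_if_percolation_dies_out:
  assumes countable: "countable (carrier G)"
    and dies: "\<And>r \<epsilon>. r \<in> carrier G \<Longrightarrow> 0 < \<epsilon> \<Longrightarrow> \<exists>B. finite B \<and> B \<subseteq> carrier G \<and> r \<in> B \<and>
      (\<Sum>D | D \<subseteq> B \<and> \<not> confined (carrier G) (cayley_edges G (set_pmf \<mu>)) r B D.
        bernoulli_weight (1 / n) B D) < \<epsilon>"
  shows "random_walk_pure_point LL (switch_walk_switch H G \<mu>)"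
proof -
  let ?conf = "confined (carrier G) (cayley_edges G (set_pmf \<mu>))"
  define E where "E = {tensor (split_mass \<eta>0 B D) r | \<eta>0 B D r. \<eta>0 \<in> configs \<and> finite B \<and>
    B \<subseteq> carrier G \<and> D \<subseteq> B \<and> r \<in> B \<and> ?conf r B D}"
  let ?F = "{A. finite A \<and> A \<subseteq> carrier G}"
  have "E \<subseteq> (\<lambda>(\<eta>0, B, D, r). tensor (split_mass \<eta>0 B D) r) ` (configs \<times> ?F \<times> ?F \<times> carrier G)"
  proof
    fix v assume "v \<in> E"
    then obtain \<eta>0 B D r where v: "v = tensor (split_mass \<eta>0 B D) r" "\<eta>0 \<in> configs" "finite B"
      "B \<subseteq> carrier G" "D \<subseteq> B" "r \<in> B" unfolding E_def by blast
    then have "(\<eta>0, B, D, r) \<in> configs \<times> ?F \<times> ?F \<times> carrier G"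
      using finite_subset by auto
    then show "v \<in> (\<lambda>(\<eta>0, B, D, r). tensor (split_mass \<eta>0 B D) r) ` (configs \<times> ?F \<times> ?F \<times> carrier G)"
      by (rule rev_image_eqI) (simp add: v(1))
  qed
  moreover have "countable (configs \<times> ?F \<times> ?F \<times> carrier G)"
    using countable countable_configs[OF countable]
    by (intro countable_SIGMA countable_Collect_finite_subset) auto
  ultimately have countable_E: "countable E"
    by (rule countable_subset[OF _ countable_image])
  have "pure_point_spectrum (carrier LL) P"
  proof (rule pure_point_spectrum_criterion[OF _ _ _ _ countable_E])
    show "P (\<lambda>x. F x + K x) = (\<lambda>x. P F x + P K x)" for F K
      by (auto simp: transition_operator_finite[OF finite_set_sws] distrib_right sum.distrib)
    show "P (\<lambda>x. c * F x) = (\<lambda>x. c * P F x)" for c F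
      by (auto simp: transition_operator_finite[OF finite_set_sws] sum_distrib_left mult.assoc)
    show "P F \<in> finsupp (carrier LL)" if "F \<in> finsupp (carrier LL)" for F
      using LL.transition_operator_finsupp[OF finite_set_sws that] .
    show "ell2_inner (carrier LL) (P F) K = ell2_inner (carrier LL) F (P K)"
      if "F \<in> finsupp (carrier LL)" "K \<in> finsupp (carrier LL)" for F K
      using LL.transition_operator_symmetric[OF finite_set_sws symmetric_sws that] .
    show "\<exists>t. finite t \<and> t \<subseteq> finsupp (carrier LL) \<and> v \<in> fun_space.span t \<and>
      (\<forall>x\<in>t. P x \<in> fun_space.span t)" if v: "v \<in> E" for v
    proof -
      obtain \<eta>0 B D r where v: "v = tensor (split_mass \<eta>0 B D) r" "\<eta>0 \<in> configs" "finite B"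
        "B \<subseteq> carrier G" "D \<subseteq> B" "r \<in> B" "?conf r B D" using v unfolding E_def by blast
      show ?thesis unfolding v(1) using v(2-7) by (rule invariant_subspace_if_confined)
    qed
    show "approximable (carrier LL) (fun_space.span E) (\<lambda>x. of_bool (x = z))" if zL: "z \<in> carrier LL" for z
      unfolding approximable_def
    proof (intro allI impI)
      obtain \<eta>0 r where z: "z = (\<eta>0, r)" "\<eta>0 \<in> configs" "r \<in> carrier G"
        using zL by (auto simp: carrier_LL)
      fix \<epsilon> :: real assume "0 < \<epsilon>"
      then obtain B where B: "finite B" "B \<subseteq> carrier G" "r \<in> B"
        "(\<Sum>D | D \<subseteq> B \<and> \<not> ?conf r B D. bernoulli_weight (1 / n) B D) < \<epsilon>"
        using dies[OF z(3)] by blast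
      let ?f = "split_mass \<eta>0 B"
      let ?good = "{D. D \<subseteq> B \<and> ?conf r B D}" and ?bad = "{D. D \<subseteq> B \<and> \<not> ?conf r B D}"
      define u where "u = (\<Sum>D\<in>?good. tensor (?f D) r)"
      have fin: "finite ?good" "finite ?bad" using B(1) by auto
      have u_eq: "u x = (\<Sum>D\<in>?good. tensor (?f D) r x)" for x
        unfolding u_def by (rule sum_fun_apply)
      \<comment> \<open>What \<open>u\<close> misses of the point mass consists of the unconfined
        parts, all at the single position \<open>r\<close>; its squared norm is therefore that of a
        lamp function.\<close>
      have rest: "of_bool (x = z) - u x = tensor (\<lambda>\<eta>. \<Sum>D\<in>?bad. ?f D \<eta>) r x" for x
      proof -
        obtain \<eta> g where x: "x = (\<eta>, g)" by (cases x)
        have "Pow B = ?good \<union> ?bad" by auto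
        then have "of_bool (\<eta> = \<eta>0) = (\<Sum>D\<in>?good. ?f D \<eta>) + (\<Sum>D\<in>?bad. ?f D \<eta>)"
          using split_mass_sum[OF z(2) B(1,2), of \<eta>] fin by (simp add: sum.union_disjoint Int_def)
        then have "(\<Sum>D\<in>?bad. ?f D \<eta>) = of_bool (\<eta> = \<eta>0) - (\<Sum>D\<in>?good. ?f D \<eta>)" by linarith
        then have "complex_of_real (\<Sum>D\<in>?bad. ?f D \<eta>) =
            of_bool (\<eta> = \<eta>0) - (\<Sum>D\<in>?good. complex_of_real (?f D \<eta>))"
          by (simp del: of_bool_eq)
        then show ?thesis
          by (cases "g = r") (auto simp: x z(1) u_eq tensor_def simp del: of_real_sum)
      qed
      have "norm2 (carrier LL) (\<lambda>x. of_bool (x = z) - u x) =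
        (\<Sum>x\<in>local_configs \<eta>0 B \<times> {r}. (cmod (tensor (\<lambda>\<eta>. \<Sum>D\<in>?bad. ?f D \<eta>) r x))\<^sup>2)"
        unfolding rest
      proof (rule norm2_finite)
        show "finite (local_configs \<eta>0 B \<times> {r})"
          using finite_local_configs[OF z(2) B(1,2)] by simp
        show "local_configs \<eta>0 B \<times> {r} \<subseteq> carrier LL"
          using z(3) by (auto simp: carrier_LL local_configs_def)
        show "tensor (\<lambda>\<eta>. \<Sum>D\<in>?bad. ?f D \<eta>) r x = 0" if "x \<notin> local_configs \<eta>0 B \<times> {r}" for x
          using that by (cases x) (auto simp: tensor_def split_mass_outside[OF z(2) B(1,2)])
      qed
      also have "\<dots> = (\<Sum>\<eta>\<in>local_configs \<eta>0 B. (\<Sum>D\<in>?bad. ?f D \<eta>)\<^sup>2)"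
        by (rule sum.reindex_bij_witness[of _ "\<lambda>\<eta>. (\<eta>, r)" fst]) (auto simp: tensor_def simp flip: of_real_sum)
      also have "\<dots> = (\<Sum>D\<in>?bad. bernoulli_weight (1 / n) B D)"
        by (rule split_mass_norm[OF z(2) B(1,2)]) auto
      also have "\<dots> < \<epsilon>" by (rule B(4))
      finally have "norm2 (carrier LL) (\<lambda>x. of_bool (x = z) - u x) < \<epsilon>" .
      moreover have "u \<in> fun_space.span E"
        unfolding u_def
      proof (intro fun_space.span_sum fun_space.span_base)
        show "tensor (?f D) r \<in> E" if "D \<in> ?good" for D
          unfolding E_def using that z B by blast
      qed
      ultimately show "\<exists>u\<in>fun_space.span E. norm2 (carrier LL) (\<lambda>x. of_bool (x = z) - u x) < \<epsilon>"
        by blast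
    qed
  qed
  then show ?thesis by (simp add: random_walk_pure_point_def)
qed

end

text \<open>Every generated element is the product of a word in the generators and their inverses.
  Countability of the group is what makes the family of invariant spaces countable.\<close>

lemma (in group) countable_generate:
  assumes "countable S" "S \<subseteq> carrier G"
  shows "countable (generate G S)"
proof -
  let ?g = "\<lambda>w. foldr (\<lambda>s y. s \<otimes> y) w \<one>"
  let ?A = "S \<union> m_inv G ` S"
  have "x \<in> ?g ` lists ?A" if "x \<in> generate G S" for x
    using that
  proof (induction rule: generate.induct)
    case one
    show ?case by (rule image_eqI[of _ _ "[]"]) auto
  next
    case (incl s)
    then show ?case using assms by (intro image_eqI[of _ _ "[s]"]) auto
  next
    case (inv s)
    then show ?case using assms by (intro image_eqI[of _ _ "[inv s]"]) auto
  next
    case (eng x y)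
    then obtain v w where vw: "v \<in> lists ?A" "w \<in> lists ?A" "x = ?g v" "y = ?g w" by blast
    have cl: "?g u \<in> carrier G" if "u \<in> lists ?A" for u
      using that assms by (induction u) auto
    have "?g (v @ w) = ?g v \<otimes> ?g w"
      using vw(1)
    proof (induction v)
      case (Cons s v)
      then have "s \<in> carrier G" "?g v \<in> carrier G" using assms cl[of v] by auto
      then show ?case using Cons cl[OF vw(2)] by (simp add: m_assoc)
    qed (use cl[OF vw(2)] in auto)
    then show ?case using vw by (intro image_eqI[of _ _ "v @ w"]) auto
  qed
  moreover have "countable (lists ?A)" using assms by auto
  ultimately show ?thesis by (meson countable_image countable_subset subsetI)
qed

theorem mainTheorem5:
  fixes G :: "('g, 'a) monoid_scheme" and H :: "('h, 'b) monoid_scheme"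
    and S :: "'g set" and \<mu> :: "'g pmf" and d :: nat
  assumes "group G" and "finite S" and "symmetric_generating_set G S"
    and "d \<ge> 1"
    and "homogeneous_tree (d + 1) (carrier G) (cayley_edges G S)"
    and "set_pmf \<mu> = S" and "symmetric_pmf G \<mu>"
    and "group H" and "finite (carrier H)"
    and "card (carrier H) \<ge> d" and "card (carrier H) \<ge> 2"
  shows "random_walk_pure_point (lamplighter H G) (switch_walk_switch H G \<mu>)"
proof -
  interpret G: group G by fact
  interpret H: group H by fact
  have SG: "S \<subseteq> carrier G" "generate G S = carrier G"
    using assms(3) by (auto simp: symmetric_generating_set_def)
  have "\<one>\<^bsub>G\<^esub> \<notin> S"
  proof
    assume "\<one>\<^bsub>G\<^esub> \<in> S"
    then have "{\<one>\<^bsub>G\<^esub>} \<in> cayley_edges G S"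
      unfolding cayley_edges_def by (force intro: exI[of _ "\<one>\<^bsub>G\<^esub>"])
    \<comment> \<open>A loop is a cycle of length one, which the tree excludes; hence every step of
      the walk changes the position.\<close>
    then have "graph_cycle (carrier G) (cayley_edges G S) [\<one>\<^bsub>G\<^esub>]"
      by (simp add: graph_cycle_def walk_def)
    then show False using assms(5) by (auto simp: homogeneous_tree_def is_tree_def)
  qed
  then interpret lamplighter_walk G H \<mu>
    using assms SG by unfold_locales auto
  show ?thesis
  proof (rule pure_point_if_percolation_dies_out)
    show "countable (carrier G)"
      using G.countable_generate[of S] assms(2) SG by (simp add: countable_finite)
    fix r and \<epsilon> :: real assume "r \<in> carrier G" "0 < \<epsilon>"
    then interpret rooted_tree "carrier G" "cayley_edges G S" r d
      using assms by unfold_locales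
    \<comment> \<open>The size of the lamp group enters here:
      \<open>card (carrier H) \<ge> d\<close> keeps \<open>1 / n\<close> at or below the critical
      value, and \<open>card (carrier H) \<ge> 2\<close> gives \<open>1 / n < 1\<close>.\<close>
    have "d * (1 / n) \<le> 1" using assms(10) n_pos by simp
    then show "\<exists>B. finite B \<and> B \<subseteq> carrier G \<and> r \<in> B \<and>
      (\<Sum>D | D \<subseteq> B \<and> \<not> confined (carrier G) (cayley_edges G (set_pmf \<mu>)) r B D.
        bernoulli_weight (1 / n) B D) < \<epsilon>"
      unfolding assms(6) using assms(11) \<open>0 < \<epsilon>\<close> by (intro percolation_dies_out) auto
  qed
qed

end
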